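(* Let $L>0$, let $g:\mathbb{R}\to\mathbb{R}$ be continuous and nondecreasing with $g(0)=0$, and let $F:\mathbb{R}\to\mathbb{R}$ be globally Lipschitz continuous with $F(0)=0$. Let $q\in(0,1/2)$, and assume that $\alpha_1|s|\le|g(s)|\le\alpha_2|s|$ for all $s\in\mathbb{R}$, for some positive constants $\alpha_1\le\alpha_2$ with $\frac{\alpha_1}{1+\alpha_2^2}>q$. Let $$\mathfrak{A}=\{[\mathbf{u},\mathbf{v}]\in\mathcal{H}:\mathcal{E}(\mathbf{u},\mathbf{v})=0\},$$ which is exactly the set of stationary solutions of the system (P). (Global.) Assume that $F$ is globally $q$-Lipschitz, and let $M,\mu>0$ be constants (they exist under these hypotheses) such that $\mathcal{E}^{\mathbf{u}}(t)\le M\exp(-\mu t)\mathcal{E}^{\mathbf{u}}(0)$ for all $t\ge0$ and every weak solution $\mathbf{u}$ of (P). Then $\mathfrak{A}$ is pointwise asymptotically stable, i.e.: - each point $\mathbf{X}\in\mathfrak{A}$ is Lyapunov stable; - for every weak solution $\mathbf{u}$ of (P), $[\mathbf{u}(t),\mathbf{u}'(t)]$ converges in $\mathcal{H}$, as $t\to+\infty$, to some limit in $\mathfrak{A}$. Furthermore, there exists a constant $M'>0$ such that, for every weak solution $\mathbf{u}$ of (P) and all $t\ge0$, $$\operatorname{dist}([\mathbf{u}(t),\mathbf{u}'(t)],\mathfrak{A})^2\le M'\exp(-\mu t)\,\mathcal{E}^{\mathbf{u}}(0).$$ (Local.) If instead $F$ is only assumed to be $q$-Lipschitz in some neighborhood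 of $0$, let $R,M,\mu>0$ be constants (they exist under these hypotheses) such that $\mathcal{E}^{\mathbf{u}}(t)\le M\exp(-\mu t)\mathcal{E}^{\mathbf{u}}(0)$ for all $t\ge0$ and every weak solution $\mathbf{u}$ of (P) with $\mathcal{E}^{\mathbf{u}}(0)\le R$. Then the same conclusions (Lyapunov stability of each point of $\mathfrak{A}$, convergence to a limit in $\mathfrak{A}$, and the uniform attractivity estimate with some constant $M'>0$) remain true for all weak solutions $\mathbf{u}$ satisfying $\mathcal{E}^{\mathbf{u}}(0)\le R$. (System (P), weak and stationary solutions, Lyapunov stability, $\mathcal{H}$, $\mathcal{E}$ and $\mathcal{E}^{\mathbf{u}}$ are defined in the context.)
   Context: Setting. Let $\Omega=(0,L)$. System (P) is $$\partial_{tt}u-\partial_{xx}u=0 \text{ on }\Omega\times\mathbb{R}^+,\qquad \partial_{tt}u(0,t)-\partial_xu(0,t)=F(\partial_tu(0,t)),\qquad \partial_xu(L,t)=-g(\partial_tu(L,t)).$$ Spaces. $H=L^2(\Omega)\times\mathbb{R}$ with scalar product $((u_1,\theta_1),(u_2,\theta_2))_H=\int_\Omega u_1u_2\,dx+\theta_1\theta_2$. $V=\{(u,u(0)):u\in H^1(\Omega)\}$, a closed subspace of $H^1(\Omega)\times\mathbb{R}$, with the inherited scalar product, so $\|\mathbf{u}\|_V^2=\|u\|_{L^2(\Omega)}^2+\|\partial_xu\|_{L^2(\Omega)}^2+|u(0)|^2$. $\mathcal{H}=V\times H$ with $\|[\mathbf{u},\mathbf{v}]\|_{\mathcal{H}}^2=\|\mathbf{u}\|_V^2+\|\mathbf{v}\|_H^2$.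 Elements of $H$ are written $\mathbf{v}=(v,\theta)$, elements of $V$ are written $\mathbf{u}=(u,u(0))$, and elements of $\mathcal{H}$ are written $[\mathbf{u},\mathbf{v}]$. $W=\{\mathbf{u}\in V:u\in H^2(\Omega)\}$. For $\mathbf{X}\in\mathcal{H}$ and $B\subset\mathcal{H}$, $\operatorname{dist}(\mathbf{X},B)=\inf_{\mathbf{Y}\in B}\|\mathbf{X}-\mathbf{Y}\|_{\mathcal{H}}$. Cauchy problem. (P) is recast as $\dot{\mathbf{X}}(t)+\mathcal{A}_g(\mathbf{X}(t))=\mathcal{F}(\mathbf{X}(t))$, $\mathbf{X}(0)=\mathbf{X}^0$, where $\mathbf{X}=[\mathbf{u},\mathbf{v}]$ with $\mathbf{v}=\mathbf{u}'$, $\mathcal{D}(\mathcal{A}_g)=\{[\mathbf{u},\mathbf{v}]\in W\times V:\partial_xu(L)=-g(v(L))\}$, $\mathcal{A}_g([\mathbf{u},\mathbf{v}])=-[\mathbf{v},(\partial_{xx}u,\partial_xu(0))]$, and $\mathcal{F}([\mathbf{u},(v,\theta)])=[0,(0,F(\theta))]$. Solutions. A strong solution is a (locally) absolutely continuous $\mathcal{H}$-valued function on $\mathbb{R}^+$ satisfying the differential equation for a.e. $t\ge0$, with initial data in $\mathcal{D}(\mathcal{A}_g)$. A weak solution, with initial data in $\mathcal{H}$, is a limit of strong solutions in $\mathcal{C}([0,T],\mathcal{H})$ for every $T>0$. It is known that for every $[\mathbf{u}^0,\mathbf{v}^0]\in\mathcal{H}$ there is a unique weak solution $[\mathbf{u},\mathbf{u}']$,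 with $\mathbf{u}\in\mathcal{C}(\mathbb{R}^+,V)\cap\mathcal{C}^1(\mathbb{R}^+,H)$; one calls $\mathbf{u}$ itself the weak solution. A stationary solution is a point $\mathbf{X}\in\mathcal{H}$ such that the constant function equal to $\mathbf{X}$ is a solution. Energy. For $[\mathbf{u},\mathbf{v}]\in\mathcal{H}$, $\mathcal{E}(\mathbf{u},\mathbf{v})=\frac12\left\{\int_\Omega|\partial_xu|^2dx+\|\mathbf{v}\|_H^2\right\}$. For a weak solution $\mathbf{u}$, $\mathcal{E}^{\mathbf{u}}(t)=\mathcal{E}(\mathbf{u}(t),\mathbf{u}'(t))$. Lyapunov stability. A point $\mathbf{Y}\in\mathfrak{A}$ is Lyapunov stable if for every $\epsilon>0$ there is $\delta>0$ such that every weak solution with initial data $\mathbf{X}^0$ satisfying $\|\mathbf{X}^0-\mathbf{Y}\|_{\mathcal{H}}\le\delta$ satisfies $\|[\mathbf{u}(t),\mathbf{u}'(t)]-\mathbf{Y}\|_{\mathcal{H}}\le\epsilon$ for all $t\ge0$; in the local case only weak solutions with $\mathcal{E}^{\mathbf{u}}(0)\le R$ are considered. A function is $q$-Lipschitz on a set if $|F(s_1)-F(s_2)|\le q|s_1-s_2|$ for all $s_1,s_2$ in that set. *)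

theory Defs
  imports "HOL-Analysis.Analysis"
begin

definition sq_integrable :: "(real \<Rightarrow> real) \<Rightarrow> bool" where
  "sq_integrable f \<longleftrightarrow> f \<in> borel_measurable lebesgue \<and> integrable lebesgue (\<lambda>x. (f x)\<^sup>2)"

definition l2_rel :: "(real \<Rightarrow> real) \<Rightarrow> (real \<Rightarrow> real) \<Rightarrow> bool" where
  "l2_rel f g \<longleftrightarrow> sq_integrable f \<and> sq_integrable g \<and> (AE x in lebesgue. f x = g x)"

lemma sq_integrable_zero: "sq_integrable (\<lambda>x. 0)"
  by (simp add: sq_integrable_def)

lemma sq_integrable_mult:
  assumes "sq_integrable f" "sq_integrable g"
  shows "integrable lebesgue (\<lambda>x. f x * g x)"
proof (rule Bochner_Integration.integrable_bound)
  show "integrable lebesgue (\<lambda>x. (f x)\<^sup>2 + (g x)\<^sup>2)"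
    using assms by (simp add: sq_integrable_def)
  show "(\<lambda>x. f x * g x) \<in> borel_measurable lebesgue"
    using assms by (auto simp: sq_integrable_def)
  have "\<bar>a * b\<bar> \<le> a\<^sup>2 + b\<^sup>2" for a b :: real
  proof -
    have "2 * (\<bar>a\<bar> * \<bar>b\<bar>) \<le> \<bar>a\<bar>\<^sup>2 + \<bar>b\<bar>\<^sup>2"
      using sum_squares_bound[of "\<bar>a\<bar>" "\<bar>b\<bar>"] by (simp only: mult.assoc)
    moreover have "0 \<le> \<bar>a\<bar> * \<bar>b\<bar>" by simp
    ultimately show ?thesis unfolding abs_mult power2_abs by linarith
  qed
  then show "AE x in lebesgue. norm (f x * g x) \<le> norm ((f x)\<^sup>2 + (g x)\<^sup>2)"
    by simp
qed

lemma sq_integrable_add: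
  assumes "sq_integrable f" "sq_integrable g"
  shows "sq_integrable (\<lambda>x. f x + g x)"
proof -
  have "integrable lebesgue (\<lambda>x. (f x)\<^sup>2 + (g x)\<^sup>2 + 2 * (f x * g x))"
    using assms sq_integrable_mult[OF assms] by (simp add: sq_integrable_def)
  then show ?thesis
    using assms by (simp add: sq_integrable_def power2_sum mult.assoc borel_measurable_add)
qed

lemma sq_integrable_scale:
  assumes "sq_integrable f"
  shows "sq_integrable (\<lambda>x. c * f x)"
  using assms by (simp add: sq_integrable_def power_mult_distrib borel_measurable_times)

lemma sq_integrable_diff:
  assumes "sq_integrable f" "sq_integrable g"
  shows "sq_integrable (\<lambda>x. f x - g x)"
  using sq_integrable_add[OF assms(1) sq_integrable_scale[OF assms(2), of "-1"]] by simp

quotient_type l2 = "real \<Rightarrow> real" / partial: l2_rel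
proof (rule part_equivpI)
  show "\<exists>f. l2_rel f f"
    using sq_integrable_zero by (auto simp: l2_rel_def)
  show "symp l2_rel"
    by (auto simp: symp_def l2_rel_def elim: eventually_mono)
  show "transp l2_rel"
    unfolding transp_def l2_rel_def by (auto elim: eventually_elim2)
qed

instantiation l2 :: real_inner
begin

lift_definition zero_l2 :: l2 is "\<lambda>x. 0"
  by (simp add: l2_rel_def sq_integrable_zero)

lift_definition plus_l2 :: "l2 \<Rightarrow> l2 \<Rightarrow> l2" is "\<lambda>f g x. f x + g x"
  by (auto simp: l2_rel_def sq_integrable_add elim: eventually_elim2)

lift_definition uminus_l2 :: "l2 \<Rightarrow> l2" is "\<lambda>f x. - f x"
  by (auto simp: l2_rel_def sq_integrable_def elim: eventually_mono)

lift_definition minus_l2 :: "l2 \<Rightarrow> l2 \<Rightarrow> l2" is "\<lambda>f g x. f x - g x"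
  by (auto simp: l2_rel_def sq_integrable_diff elim: eventually_elim2)

lift_definition scaleR_l2 :: "real \<Rightarrow> l2 \<Rightarrow> l2" is "\<lambda>c f x. c * f x"
  by (auto simp: l2_rel_def sq_integrable_scale elim: eventually_mono)

lift_definition inner_l2 :: "l2 \<Rightarrow> l2 \<Rightarrow> real" is "\<lambda>f g. (\<integral>x. f x * g x \<partial>lebesgue)"
  unfolding l2_rel_def
  by (rule integral_cong_AE) (auto simp: sq_integrable_def elim: eventually_elim2)

definition norm_l2 :: "l2 \<Rightarrow> real" where "norm_l2 f = sqrt (inner f f)"
definition dist_l2 :: "l2 \<Rightarrow> l2 \<Rightarrow> real" where "dist_l2 f g = norm (f - g)"
definition sgn_l2 :: "l2 \<Rightarrow> l2" where "sgn_l2 f = scaleR (inverse (norm f)) f"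
definition uniformity_l2 :: "(l2 \<times> l2) filter" where
  "uniformity_l2 = (INF e\<in>{0<..}. principal {(f, g). dist f g < e})"
definition open_l2 :: "l2 set \<Rightarrow> bool" where
  "open_l2 U \<longleftrightarrow> (\<forall>f\<in>U. \<forall>\<^sub>F (f', g) in uniformity. f' = f \<longrightarrow> g \<in> U)"

instance
proof
  fix f g h :: l2 and a b :: real and U :: "l2 set"
  show "f + g + h = f + (g + h)"
    by transfer (auto simp: l2_rel_def sq_integrable_add add.assoc)
  show "f + g = g + f"
    by transfer (auto simp: l2_rel_def sq_integrable_add add.commute)
  show "0 + f = f"
    by transfer (auto simp: l2_rel_def)
  show "- f + f = 0"
    by transfer (auto simp: l2_rel_def sq_integrable_zero)
  show "f - g = f + - g"
    by transfer (simp add: l2_rel_def sq_integrable_diff)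
  show "a *\<^sub>R (f + g) = a *\<^sub>R f + a *\<^sub>R g"
    by transfer (auto simp: l2_rel_def sq_integrable_add sq_integrable_scale distrib_left)
  show "(a + b) *\<^sub>R f = a *\<^sub>R f + b *\<^sub>R f"
    by transfer (auto simp: l2_rel_def sq_integrable_add sq_integrable_scale distrib_right)
  show "a *\<^sub>R b *\<^sub>R f = (a * b) *\<^sub>R f"
    by transfer (auto simp: l2_rel_def sq_integrable_scale mult.assoc)
  show "1 *\<^sub>R f = f"
    by transfer (auto simp: l2_rel_def)
  show "dist f g = norm (f - g)" by (rule dist_l2_def)
  show "sgn f = inverse (norm f) *\<^sub>R f" by (rule sgn_l2_def)
  show "(uniformity :: (l2 \<times> l2) filter) = (INF e\<in>{0<..}. principal {(f, g). dist f g < e})"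
    by (rule uniformity_l2_def)
  show "open U \<longleftrightarrow> (\<forall>f\<in>U. \<forall>\<^sub>F (f', g) in uniformity. f' = f \<longrightarrow> g \<in> U)"
    by (rule open_l2_def)
  show "inner f g = inner g f"
    by transfer (simp add: mult.commute)
  show "inner (f + g) h = inner f h + inner g h"
    by transfer (simp add: l2_rel_def distrib_right sq_integrable_mult)
  show "inner (a *\<^sub>R f) g = a * inner f g"
    by transfer (simp add: mult.assoc)
  show "0 \<le> inner f f"
    by transfer simp
  show "inner f f = 0 \<longleftrightarrow> f = 0"
  proof transfer
    fix f assume "l2_rel f f"
    then have f: "sq_integrable f" by (simp add: l2_rel_def)
    then have "(\<integral>x. (f x)\<^sup>2 \<partial>lebesgue) = 0 \<longleftrightarrow> (AE x in lebesgue. (f x)\<^sup>2 = 0)"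
      by (intro integral_nonneg_eq_0_iff_AE) (auto simp: sq_integrable_def)
    then show "(\<integral>x. f x * f x \<partial>lebesgue) = 0 \<longleftrightarrow> l2_rel f (\<lambda>x. 0)"
      using f sq_integrable_zero by (simp add: l2_rel_def power2_eq_square)
  qed
  show "norm f = sqrt (inner f f)" by (rule norm_l2_def)
qed

end

lemma norm_l2_square: "(norm f)\<^sup>2 = (\<integral>x. (rep_l2 f x)\<^sup>2 \<partial>lebesgue)"
proof -
  have "inner f f = (\<integral>x. rep_l2 f x * rep_l2 f x \<partial>lebesgue)"
    unfolding inner_l2_def by (simp add: map_fun_def)
  then show ?thesis
    by (simp only: power2_norm_eq_inner) (simp only: power2_eq_square)
qed

text \<open>\<^typ>\<open>l2\<close> is \<open>L\<^sup>2(\<real>)\<close>, with almost everywhere equal functions identified.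
  \<open>L\<^sup>2(0,L)\<close> is embedded isometrically into \<^typ>\<open>l2\<close> by extending functions by zero
  outside \<open>(0,L)\<close>.\<close>

definition L2 :: "real \<Rightarrow> l2 set" where
  "L2 L = {f. AE x in lebesgue. x \<notin> {0<..<L} \<longrightarrow> rep_l2 f x = 0}"

definition test_function :: "real \<Rightarrow> (real \<Rightarrow> real) \<Rightarrow> bool" where
  "test_function L \<phi> \<longleftrightarrow>
     \<phi> C1_differentiable_on UNIV \<and>
     compact (closure {x. \<phi> x \<noteq> 0}) \<and> closure {x. \<phi> x \<noteq> 0} \<subseteq> {0<..<L}"

definition weak_deriv :: "real \<Rightarrow> l2 \<Rightarrow> l2 \<Rightarrow> bool" where
  "weak_deriv L u w \<longleftrightarrow>
     (\<forall>\<phi>. test_function L \<phi> \<longrightarrow>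
        (LINT x:{0<..<L}|lebesgue. rep_l2 u x * deriv \<phi> x)
          = - (LINT x:{0<..<L}|lebesgue. rep_l2 w x * \<phi> x))"

text \<open>\<open>H\<^sup>1(0,L)\<close> is represented by the graph of the weak derivative, that is, a function
  \<open>u\<close> is represented by the pair \<open>(u, \<partial>\<^sub>xu)\<close>. The norm of this pair in the product space is then
  the norm of \<open>u\<close> in \<open>H\<^sup>1(0,L)\<close>.\<close>

type_synonym h1 = "l2 \<times> l2"

definition H1 :: "real \<Rightarrow> h1 set" where
  "H1 L = {(u, w). u \<in> L2 L \<and> w \<in> L2 L \<and> weak_deriv L u w}"

definition dx :: "real \<Rightarrow> l2 \<Rightarrow> l2" where
  "dx L u = (THE w. (u, w) \<in> H1 L)"

text \<open>The value at \<open>x \<in> [0,L]\<close> of the continuous representative.\<close>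

definition pt_val :: "real \<Rightarrow> l2 \<Rightarrow> real \<Rightarrow> real" where
  "pt_val L u x = (THE a. \<exists>h. continuous_on {0..L} h \<and>
     (AE y in lebesgue. y \<in> {0<..<L} \<longrightarrow> rep_l2 u y = h y) \<and> a = h x)"

text \<open>Elements \<open>[(u, u(0)), (v, \<theta>)]\<close> of the phase space become \<open>(((u, \<partial>\<^sub>xu), u(0)), (v, \<theta>))\<close>. The norms
  of \<open>H\<close>, \<open>V\<close> and the phase space are then the norms of the product types.\<close>

type_synonym state = "(h1 \<times> real) \<times> (l2 \<times> real)"

definition H_space :: "real \<Rightarrow> (l2 \<times> real) set" where
  "H_space L = L2 L \<times> UNIV"

definition V_space :: "real \<Rightarrow> (h1 \<times> real) set" where
  "V_space L = {((u, ux), a). (u, ux) \<in> H1 L \<and> a = pt_val L u 0}"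

definition W_space :: "real \<Rightarrow> (h1 \<times> real) set" where
  "W_space L = {((u, ux), a) \<in> V_space L. \<exists>uxx. (ux, uxx) \<in> H1 L}"

definition state_space :: "real \<Rightarrow> state set" where
  "state_space L = V_space L \<times> H_space L"

lemma norm_state_square:
  "(norm ((((u, ux), a), (v, \<theta>)) :: state))\<^sup>2
     = (norm u)\<^sup>2 + (norm ux)\<^sup>2 + a\<^sup>2 + ((norm v)\<^sup>2 + \<theta>\<^sup>2)"
  by (simp add: norm_Pair)

fun energy :: "state \<Rightarrow> real" where
  "energy (((u, ux), a), (v, \<theta>)) = 1/2 * ((norm ux)\<^sup>2 + (norm (v, \<theta>))\<^sup>2)"

definition zero_energy :: "real \<Rightarrow> state set" where
  "zero_energy L = {X \<in> state_space L. energy X = 0}"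

text \<open>The second component \<open>(v, \<theta>)\<close> of a state in the domain belongs to \<open>V\<close>, as a subspace of \<open>H\<close>;
  in \<open>A_op\<close> it is moved to the first component, where its derivative has to be added.\<close>

definition dom_A :: "real \<Rightarrow> (real \<Rightarrow> real) \<Rightarrow> state set" where
  "dom_A L g = {(((u, ux), a), (v, \<theta>)).
     ((u, ux), a) \<in> W_space L \<and> ((v, dx L v), \<theta>) \<in> V_space L \<and>
     pt_val L ux L = - g (pt_val L v L)}"

fun A_op :: "real \<Rightarrow> state \<Rightarrow> state" where
  "A_op L (((u, ux), a), (v, \<theta>)) = - (((v, dx L v), \<theta>), (dx L ux, pt_val L ux 0))"

fun F_op :: "(real \<Rightarrow> real) \<Rightarrow> state \<Rightarrow> state" where
  "F_op F (((u, ux), a), (v, \<theta>)) = (0, (0, F \<theta>))"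

definition abs_cont_on :: "real \<Rightarrow> real \<Rightarrow> (real \<Rightarrow> 'a::real_normed_vector) \<Rightarrow> bool" where
  "abs_cont_on c d X \<longleftrightarrow>
     (\<forall>\<epsilon>>0. \<exists>\<delta>>0. \<forall>(n::nat) a b.
        (\<forall>i<n. c \<le> a i \<and> a i \<le> b i \<and> b i \<le> d) \<longrightarrow>
        (\<forall>i<n. \<forall>j<n. i \<noteq> j \<longrightarrow> {a i<..<b i} \<inter> {a j<..<b j} = {}) \<longrightarrow>
        (\<Sum>i<n. b i - a i) < \<delta> \<longrightarrow>
        (\<Sum>i<n. norm (X (b i) - X (a i))) < \<epsilon>)"

definition strong_solution ::
  "real \<Rightarrow> (real \<Rightarrow> real) \<Rightarrow> (real \<Rightarrow> real) \<Rightarrow> (real \<Rightarrow> state) \<Rightarrow> bool" where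
  "strong_solution L g F X \<longleftrightarrow>
     (\<forall>t\<ge>0. X t \<in> state_space L) \<and>
     (\<forall>T>0. abs_cont_on 0 T X) \<and>
     X 0 \<in> dom_A L g \<and>
     (AE t in lebesgue. t \<ge> 0 \<longrightarrow> X t \<in> dom_A L g \<and>
        (\<exists>X'. (X has_vector_derivative X') (at t within {0..}) \<and> X' + A_op L (X t) = F_op F (X t)))"

text \<open>A weak solution \<open>u\<close> is represented by the trajectory \<open>X = [u, u']\<close>.\<close>

definition weak_solution ::
  "real \<Rightarrow> (real \<Rightarrow> real) \<Rightarrow> (real \<Rightarrow> real) \<Rightarrow> (real \<Rightarrow> state) \<Rightarrow> bool" where
  "weak_solution L g F X \<longleftrightarrow>
     (\<forall>t\<ge>0. X t \<in> state_space L) \<and>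
     (\<exists>Y. (\<forall>n::nat. strong_solution L g F (Y n)) \<and>
        (\<forall>T>0. uniform_limit {0..T} Y X sequentially))"

definition stationary_solution ::
  "real \<Rightarrow> (real \<Rightarrow> real) \<Rightarrow> (real \<Rightarrow> real) \<Rightarrow> state \<Rightarrow> bool" where
  "stationary_solution L g F X \<longleftrightarrow> X \<in> state_space L \<and> weak_solution L g F (\<lambda>t. X)"

text \<open>Stability notions are relative to the set \<open>S\<close> of trajectories under consideration.\<close>

definition lyapunov_stable :: "(real \<Rightarrow> 'a::real_normed_vector) set \<Rightarrow> 'a \<Rightarrow> bool" where
  "lyapunov_stable S Y \<longleftrightarrow>
     (\<forall>\<epsilon>>0. \<exists>\<delta>>0. \<forall>X\<in>S. norm (X 0 - Y) \<le> \<delta> \<longrightarrow> (\<forall>t\<ge>0. norm (X t - Y) \<le> \<epsilon>))"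

definition pointwise_asymptotically_stable ::
  "(real \<Rightarrow> 'a::real_normed_vector) set \<Rightarrow> 'a set \<Rightarrow> bool" where
  "pointwise_asymptotically_stable S B \<longleftrightarrow>
     (\<forall>Y\<in>B. lyapunov_stable S Y) \<and> (\<forall>X\<in>S. \<exists>Y\<in>B. (X \<longlongrightarrow> Y) at_top)"

end

theory Submission
  imports Defs
begin

text \<open>
  The trace \<open>a(t) = u(0,t)\<close> satisfies \<open>a' = \<theta>\<close>, where \<open>\<theta>\<^sup>2\<close> is at most twice the energy. Exponential decay
  of the energy therefore makes \<open>\<theta>\<close> integrable in time, so that \<open>a\<close> converges and its total variation is
  bounded by a multiple of the square root of the initial energy. The equilibrium \<open>(a(t), 0)\<close>, with \<open>a(t)\<close>
  as a constant displacement, stays within a multiple of the square root of the energy of the state, by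
  the inequality \<open>\<parallel>u - u(0)\<parallel> \<le> L \<parallel>\<partial>\<^sub>xu\<parallel>\<close>. This yields convergence, Lyapunov stability and the estimate on
  the distance without any compactness argument.

  For a stationary solution, integrating \<open>u' = v\<close> and \<open>a' = \<theta>\<close> in time gives \<open>v = 0\<close> and \<open>\<theta> = 0\<close>. Testing
  the momentum equation with \<open>\<phi>(x) = \<integral>\<^sub>x\<^sup>L \<partial>\<^sub>xu\<close>, which vanishes at \<open>L\<close> and hence does not see the boundary
  feedback there, gives \<open>\<parallel>\<partial>\<^sub>xu\<parallel>\<^sup>2 = 0\<close>.
\<close>

subsection \<open>Absolutely continuous functions\<close>

text \<open>Outer regularity puts the null set \<open>N\<close> into an open set of measure below
  the \<open>\<delta>\<close> of absolute continuity. Non-overlapping intervals inside that set have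
  total length below \<open>\<delta>\<close>, wherever their tags lie. This handles the exceptional
  tags in the fundamental theorem below.\<close>

lemma interval_family_negligible_cover:
  fixes f :: "real \<Rightarrow> 'a::real_normed_vector"
  assumes ac: "abs_cont_on a b f" and "negligible N" and "\<epsilon> > 0"
  obtains U where "open U" "N \<subseteq> U"
    "\<forall>p. p tagged_partial_division_of {a..b} \<longrightarrow> \<Union>(snd ` p) \<subseteq> U
      \<longrightarrow> (\<Sum>(x, K)\<in>p. norm (f (Sup K) - f (Inf K))) < \<epsilon>"
proof -
  from ac[unfolded abs_cont_on_def, THEN spec, THEN mp, OF \<open>\<epsilon> > 0\<close>]
  obtain \<delta> where \<delta>: "\<delta> > 0 \<and> (\<forall>(n::nat) u v.
        (\<forall>i<n. a \<le> u i \<and> u i \<le> v i \<and> v i \<le> b) \<longrightarrow>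
        (\<forall>i<n. \<forall>j<n. i \<noteq> j \<longrightarrow> {u i<..<v i} \<inter> {u j<..<v j} = {}) \<longrightarrow>
        (\<Sum>i<n. v i - u i) < \<delta> \<longrightarrow> (\<Sum>i<n. norm (f (v i) - f (u i))) < \<epsilon>)" ..
  then have "\<delta> > 0" ..
  have N: "N \<in> null_sets lebesgue"
    using \<open>negligible N\<close> by (simp add: negligible_iff_null_sets)
  then obtain U where U: "open U" "N \<subseteq> U" "U - N \<in> lmeasurable" "emeasure lebesgue (U - N) < ennreal \<delta>"
    using sets_lebesgue_outer_open[of N \<delta>] \<open>\<delta> > 0\<close> by blast
  have Um: "U \<in> lmeasurable"
    using U(2,3) N by (metis Diff_partition Un_commute fmeasurable.Un fmeasurableI_null_sets)
  have "emeasure lebesgue U = emeasure lebesgue (U - N)"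
    using N U(1) by (simp add: emeasure_Diff_null_set)
  then have mU: "measure lebesgue U < \<delta>"
    using U(4) Um \<open>\<delta> > 0\<close>
    by (metis emeasure_eq_measure2 ennreal_less_iff measure_nonneg)
  show ?thesis
  proof (rule that[OF U(1,2)], intro allI impI)
    fix p assume p: "p tagged_partial_division_of {a..b}" and pU: "\<Union>(snd ` p) \<subseteq> U"
    have fin: "finite p" using p by (simp add: tagged_partial_division_of_def)
    \<comment> \<open>Absolute continuity speaks of families indexed by an initial segment of the
      naturals, so the tagged intervals are enumerated. Since their interiors are disjoint, the sum
      of the lengths is the measure of a subset of \<open>U\<close>.\<close>
    obtain h where h: "bij_betw h {..<card p} p"
      using fin ex_bij_betw_nat_finite atLeast0LessThan by metis
    let ?K = "\<lambda>i. snd (h i)"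
    have K: "\<exists>u v. K = {u..v} \<and> u \<le> v \<and> a \<le> u \<and> v \<le> b" if "(x, K) \<in> p" for x K
    proof -
      obtain u v where "K = cbox u v" "x \<in> K" "K \<subseteq> {a..b}"
        using p \<open>(x, K) \<in> p\<close> unfolding tagged_partial_division_of_def by (metis (no_types, lifting))
      then show ?thesis by (intro exI[of _ u] exI[of _ v]) auto
    qed
    have hp: "h i \<in> p" if "i < card p" for i
      using h that by (auto simp: bij_betw_def)
    have 1: "\<forall>i<card p. a \<le> Inf (?K i) \<and> Inf (?K i) \<le> Sup (?K i) \<and> Sup (?K i) \<le> b"
    proof (intro allI impI)
      fix i assume "i < card p"
      then obtain u v where "?K i = {u..v}" "u \<le> v" "a \<le> u" "v \<le> b"
        using K[of "fst (h i)" "?K i"] hp[of i] by auto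
      then show "a \<le> Inf (?K i) \<and> Inf (?K i) \<le> Sup (?K i) \<and> Sup (?K i) \<le> b" by simp
    qed
    have int: "interior K \<inter> interior K' = {}" if "(x, K) \<in> p" "(x', K') \<in> p" "(x, K) \<noteq> (x', K')" for x K x' K'
      using p that unfolding tagged_partial_division_of_def by blast
    have ioo: "interior K = {Inf K<..<Sup K}" if "(x, K) \<in> p" for x K
      using K[OF that] by (metis cInf_atLeastAtMost cSup_atLeastAtMost interior_atLeastAtMost_real)
    have ioo': "interior (?K i) = {Inf (?K i)<..<Sup (?K i)}" if "i < card p" for i
      using ioo[of "fst (h i)" "?K i"] hp[OF that] by simp
    have 2: "\<forall>i<card p. \<forall>j<card p. i \<noteq> j \<longrightarrow> {Inf (?K i)<..<Sup (?K i)} \<inter> {Inf (?K j)<..<Sup (?K j)} = {}"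
    proof (intro allI impI)
      fix i j assume ij: "i < card p" "j < card p" "i \<noteq> j"
      then have "h i \<noteq> h j" using h by (auto simp: bij_betw_def inj_on_def)
      then show "{Inf (?K i)<..<Sup (?K i)} \<inter> {Inf (?K j)<..<Sup (?K j)} = {}"
        using int[of "fst (h i)" "?K i" "fst (h j)" "?K j"] ioo[of "fst (h i)" "?K i"] ioo[of "fst (h j)" "?K j"]
          hp[OF ij(1)] hp[OF ij(2)] by (metis prod.collapse)
    qed
    have "(\<Sum>i<card p. Sup (?K i) - Inf (?K i)) = (\<Sum>i<card p. measure lebesgue (interior (?K i)))"
      using 1 by (intro sum.cong refl) (simp add: ioo')
    also have "\<dots> = measure lebesgue (\<Union>i<card p. interior (?K i))"
    proof (rule measure_UNION'[symmetric])
      show "pairwise (\<lambda>i j. disjnt (interior (?K i)) (interior (?K j))) {..<card p}"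
        unfolding pairwise_def disjnt_def
        using 2 by (simp add: ioo')
    next
      show "interior (?K i) \<in> lmeasurable" if "i \<in> {..<card p}" for i
        using that by (simp add: ioo')
    qed simp
    also have "\<dots> \<le> measure lebesgue U"
    proof (rule measure_mono_fmeasurable)
      show "(\<Union>i<card p. interior (?K i)) \<subseteq> U"
      proof (rule UN_least)
        fix i assume "i \<in> {..<card p}"
        then have "?K i \<subseteq> U" using pU hp[of i] by blast
        then show "interior (?K i) \<subseteq> U" using interior_subset by blast
      qed
    qed (use Um in auto)
    finally have 3: "(\<Sum>i<card p. Sup (?K i) - Inf (?K i)) < \<delta>" using mU by simp
    have "(\<Sum>i<card p. norm (f (Sup (?K i)) - f (Inf (?K i)))) < \<epsilon>"
      by (rule conjunct2[OF \<delta>, rule_format, OF 1[rule_format] 2[rule_format] 3])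
    moreover have "(\<Sum>i<card p. norm (f (Sup (?K i)) - f (Inf (?K i)))) = (\<Sum>z\<in>p. norm (f (Sup (snd z)) - f (Inf (snd z))))"
      by (rule sum.reindex_bij_betw[OF h])
    ultimately show "(\<Sum>(x, K)\<in>p. norm (f (Sup K) - f (Inf K))) < \<epsilon>"
      by (simp add: case_prod_unfold)
  qed
qed

text \<open>A gauge argument that works for values in any normed space, in particular
  \<open>state\<close>. Tags outside \<open>N\<close> get the gauge supplied by differentiability;
  tags in \<open>N\<close> get the open cover of the previous lemma, on which the increments of
  \<open>f\<close> are small in total.\<close>

theorem fundamental_theorem_of_calculus_abs_cont:
  fixes f :: "real \<Rightarrow> 'a::real_normed_vector"
  assumes "a \<le> b" and ac: "abs_cont_on a b f" and N: "negligible N"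
    and der: "\<And>x. x \<in> {a..b} - N \<Longrightarrow> (f has_vector_derivative f' x) (at x within {a..b})"
  shows "(f' has_integral (f b - f a)) {a..b}"
proof -
  \<comment> \<open>With the value 0 on \<open>N\<close>, an exceptional tag contributes nothing but
    an increment of \<open>f\<close> to the error of the Riemann sum.\<close>
  define g where "g = (\<lambda>x. if x \<in> N then 0 else f' x)"
  have "(g has_integral (f b - f a)) {a..b}"
    unfolding has_integral_real
  proof (intro allI impI)
    fix e :: real assume "e > 0"
    \<comment> \<open>The summand 1 keeps the denominator positive when
      \<open>a = b\<close>.\<close>
    define \<eta> where "\<eta> = e / (2 * (b - a + 1))"
    have "\<eta> > 0" using \<open>e > 0\<close> \<open>a \<le> b\<close> by (simp add: \<eta>_def)
    have \<eta>ba: "\<eta> * (b - a) \<le> e / 2"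
      using \<open>e > 0\<close> \<open>a \<le> b\<close> by (simp add: \<eta>_def field_simps)
    obtain U where U: "open U" "N \<subseteq> U" and sumU:
       "\<forall>p. p tagged_partial_division_of {a..b} \<longrightarrow> \<Union>(snd ` p) \<subseteq> U
          \<longrightarrow> (\<Sum>(x, K)\<in>p. norm (f (Sup K) - f (Inf K))) < e / 2"
      by (rule interval_family_negligible_cover[OF ac N half_gt_zero[OF \<open>e > 0\<close>]]) (rule that)
    have "\<forall>x. \<exists>d>0. x \<in> {a..b} - N \<longrightarrow>
         (\<forall>y\<in>{a..b}. norm (y-x) < d \<longrightarrow> norm (f y - f x - (y-x) *\<^sub>R f' x) \<le> \<eta> * norm (y-x))"
      using der[unfolded has_vector_derivative_def has_derivative_within_alt] \<open>\<eta> > 0\<close> by blast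
    then obtain d where d: "\<And>x. 0 < d x"
        "\<And>x y. \<lbrakk>x \<in> {a..b} - N; y \<in> {a..b}; norm (y-x) < d x\<rbrakk>
           \<Longrightarrow> norm (f y - f x - (y-x) *\<^sub>R f' x) \<le> \<eta> * norm (y-x)"
      by metis
    define \<gamma> where "\<gamma> x = (if x \<in> N then U else ball x (d x))" for x
    show "\<exists>\<gamma>. gauge \<gamma> \<and> (\<forall>\<D>. \<D> tagged_division_of {a..b} \<and> \<gamma> fine \<D> \<longrightarrow>
        norm ((\<Sum>(x, k)\<in>\<D>. measure lborel k *\<^sub>R g x) - (f b - f a)) < e)"
    proof (intro exI[of _ \<gamma>] conjI allI impI, goal_cases)
      case 1
      show "gauge \<gamma>"
      using U d(1) by (auto simp: gauge_def \<gamma>_def)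
    next
      case (2 p)
      then have p: "p tagged_division_of {a..b}" and fine: "\<gamma> fine p" by auto
      have fin: "finite p" using p by blast
      define p1 where "p1 = {z\<in>p. fst z \<in> N}"
      define p2 where "p2 = {z\<in>p. fst z \<notin> N}"
      have pp: "p = p1 \<union> p2" "p1 \<inter> p2 = {}" "p1 \<subseteq> p" "p2 \<subseteq> p" by (auto simp: p1_def p2_def)
      have ba: "b - a = (\<Sum>(x,K)\<in>p. Sup K - Inf K)" "f b - f a = (\<Sum>(x,K)\<in>p. f(Sup K) - f(Inf K))"
        using additive_tagged_division_1[where f= "\<lambda>x. x"] additive_tagged_division_1[where f= f]
              \<open>a \<le> b\<close> p by auto
      have K: "\<exists>u v. K = {u..v} \<and> u \<le> x \<and> x \<le> v \<and> a \<le> u \<and> v \<le> b" if "(x, K) \<in> p" for x K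
      proof -
        obtain u v where "K = cbox u v" "x \<in> K" "K \<subseteq> {a..b}"
          using p \<open>(x, K) \<in> p\<close> by (metis tagged_division_ofD(2,3,4))
        then show ?thesis by (intro exI[of _ u] exI[of _ v]) auto
      qed
      define S where "S q = (\<Sum>(x, K)\<in>q. norm (measure lborel K *\<^sub>R g x - (f (Sup K) - f (Inf K))))" for q
      have "(\<Sum>(x, K)\<in>p1. norm (f (Sup K) - f (Inf K))) < e / 2"
      proof (rule sumU[rule_format])
        show "p1 tagged_partial_division_of {a..b}"
          using p pp(3) by (meson tagged_division_of_def tagged_partial_division_subset)
        show "\<Union>(snd ` p1) \<subseteq> U"
          using fine by (fastforce simp: fine_def \<gamma>_def p1_def)
      qed
      moreover have "S p1 = (\<Sum>(x, K)\<in>p1. norm (f (Sup K) - f (Inf K)))"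
        unfolding S_def by (intro sum.cong refl) (auto simp: p1_def g_def norm_minus_commute)
      moreover have "S p2 \<le> e / 2"
      proof -
        have "S p2 \<le> (\<Sum>(x, K)\<in>p2. \<eta> * (Sup K - Inf K))"
          unfolding S_def
        proof (rule sum_mono, clarify)
          fix x K assume xK: "(x, K) \<in> p2"
          then have xN: "x \<notin> N" and "(x, K) \<in> p" by (auto simp: p2_def)
          then obtain u v where k: "K = {u..v}" and uv: "u \<le> x" "x \<le> v" "a \<le> u" "v \<le> b"
            using K by blast
          have x: "x \<in> {a..b} - N" using uv xN by auto
          have "K \<subseteq> ball x (d x)" using fine \<open>(x, K) \<in> p\<close> xN by (fastforce simp: fine_def \<gamma>_def)
          then have b: "norm (u - x) < d x" "norm (v - x) < d x"
            using uv subsetD[of K "ball x (d x)" u] subsetD[of K "ball x (d x)" v]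
            by (auto simp: k dist_real_def abs_minus_commute)
          \<comment> \<open>The increment over \<open>K\<close> is split at its tag. Because
            \<open>x\<close> lies between \<open>u\<close> and \<open>v\<close>, the two
            linearisation errors add up to \<open>\<eta>\<close> times the length.\<close>
          have "norm ((v - u) *\<^sub>R f' x - (f v - f u)) = norm ((f u - f x - (u - x) *\<^sub>R f' x) - (f v - f x - (v - x) *\<^sub>R f' x))"
            by (rule arg_cong[where f=norm]) (simp add: algebra_simps)
          also have "\<dots> \<le> norm (f u - f x - (u - x) *\<^sub>R f' x) + norm (f v - f x - (v - x) *\<^sub>R f' x)"
            by (rule norm_triangle_ineq4)
          also have "\<dots> \<le> \<eta> * norm (u - x) + \<eta> * norm (v - x)"
            using d(2)[OF x _ b(1)] d(2)[OF x _ b(2)] uv by (intro add_mono) auto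
          also have "\<dots> = \<eta> * (v - u)" using uv by (simp add: algebra_simps)
          finally show "norm (measure lborel K *\<^sub>R g x - (f (Sup K) - f (Inf K))) \<le> \<eta> * (Sup K - Inf K)"
            using uv xN by (simp add: k g_def)
        qed
        also have "\<dots> \<le> (\<Sum>(x, K)\<in>p. \<eta> * (Sup K - Inf K))"
          using pp(4) fin \<open>\<eta> > 0\<close> by (intro sum_mono2) (fastforce dest: K)+
        also have "\<dots> = \<eta> * (b - a)"
          unfolding ba(1) by (simp add: sum_distrib_left case_prod_unfold)
        finally show ?thesis using \<eta>ba by simp
      qed
      moreover have "norm ((\<Sum>(x, K)\<in>p. measure lborel K *\<^sub>R g x) - (f b - f a)) \<le> S p"
      proof -
        have "(\<Sum>(x, K)\<in>p. measure lborel K *\<^sub>R g x) - (f b - f a)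
            = (\<Sum>(x, K)\<in>p. measure lborel K *\<^sub>R g x - (f (Sup K) - f (Inf K)))"
          unfolding ba(2) by (simp add: sum_subtractf case_prod_unfold)
        then show ?thesis
          using norm_sum[of "\<lambda>(x, K). measure lborel K *\<^sub>R g x - (f (Sup K) - f (Inf K))" p]
          unfolding S_def by (simp add: case_prod_unfold)
      qed
      moreover have "S p = S p1 + S p2"
        unfolding S_def using fin pp by (metis (no_types, lifting) finite_subset sum.union_disjoint)
      ultimately show ?case by linarith
    qed
  qed
  then show ?thesis
    by (rule has_integral_spike[OF N, rotated]) (auto simp: g_def)
qed

lemma abs_cont_on_imp_continuous_on:
  assumes "abs_cont_on a b f"
  shows "continuous_on {a..b} f"
  unfolding continuous_on_iff
proof (intro ballI allI impI)
  fix x e :: real assume x: "x \<in> {a..b}" and "e > 0"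
  from assms[unfolded abs_cont_on_def, THEN spec, THEN mp, OF \<open>e > 0\<close>]
  obtain \<delta> where \<delta>: "\<delta> > 0 \<and> (\<forall>(n::nat) u v.
        (\<forall>i<n. a \<le> u i \<and> u i \<le> v i \<and> v i \<le> b) \<longrightarrow>
        (\<forall>i<n. \<forall>j<n. i \<noteq> j \<longrightarrow> {u i<..<v i} \<inter> {u j<..<v j} = {}) \<longrightarrow>
        (\<Sum>i<n. v i - u i) < \<delta> \<longrightarrow> (\<Sum>i<n. norm (f (v i) - f (u i))) < e)" ..
  have "dist (f y) (f x) < e" if y: "y \<in> {a..b}" "dist y x < \<delta>" for y
    \<comment> \<open>A family of one interval; \<open>min\<close> and \<open>max\<close> treat both
      orders of \<open>x\<close> and \<open>y\<close>.\<close>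
    using conjunct2[OF \<delta>, rule_format, of 1 "\<lambda>_. min x y" "\<lambda>_. max x y"] x y
    by (cases "x \<le> y") (auto simp: dist_norm norm_minus_commute)
  then show "\<exists>d>0. \<forall>y\<in>{a..b}. dist y x < d \<longrightarrow> dist (f y) (f x) < e" using \<delta> by blast
qed

subsection \<open>Lebesgue integrals over intervals\<close>

lemma sigma_finite_lebesgue: "sigma_finite_measure (lebesgue :: 'a::euclidean_space measure)"
proof
  obtain A :: "'a set set" where "countable A" "A \<subseteq> sets lborel" "\<Union>A = space lborel" "\<forall>a\<in>A. emeasure lborel a \<noteq> \<infinity>"
    using lborel.sigma_finite_countable by blast
  then show "\<exists>A::'a set set. countable A \<and> A \<subseteq> sets lebesgue \<and> \<Union>A = space lebesgue \<and> (\<forall>a\<in>A. emeasure lebesgue a \<noteq> \<infinity>)"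
    by (intro exI[of _ A]) (auto simp: subset_iff)
qed

text \<open>Open intervals are an intersection-stable generator of the Borel sets, so vanishing of
  the integrals spreads to all Borel sets by Dynkin's argument, and then to Lebesgue sets, which
  differ from Borel sets by null sets. A density with zero integral over every measurable set
  vanishes almost everywhere.\<close>

lemma AE_eq_0_if_interval_integrals_eq_0:
  fixes f :: "real \<Rightarrow> real"
  assumes f: "integrable lebesgue f" and supp: "\<And>x. x \<notin> {c<..<d} \<Longrightarrow> f x = 0"
    and zero: "\<And>a b. (LINT x:{a<..<b}|lebesgue. f x) = 0"
  shows "AE x in lebesgue. f x = 0"
proof (rule sigma_finite_measure.density_zero[OF sigma_finite_lebesgue f])
  have si: "set_integrable lebesgue A f" if "A \<in> sets lebesgue" for A
    using f that unfolding set_integrable_def by (rule integrable_mult_indicator[rotated])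
  \<comment> \<open>Complements in the induction need the integral over the whole line; the support
    condition reduces it to one interval.\<close>
  have total: "integral\<^sup>L lebesgue f = 0"
    using zero[of c d] supp unfolding set_lebesgue_integral_def
    by (metis (no_types, lifting) Bochner_Integration.integral_cong indicator_simps(1) indicator_simps(2) scaleR_one scaleR_zero_left)
  have borel: "(LINT x:A|lebesgue. f x) = 0" if "A \<in> sets borel" for A
  proof -
    let ?G = "range (\<lambda>(a, b). box a b :: real set)"
    have G: "sigma_sets UNIV ?G = sets borel"
      unfolding borel_eq_box by (rule sets_measure_of[symmetric]) simp
    have A: "A \<in> sigma_sets UNIV ?G"
      using that by (simp only: G)
    have sb: "B \<in> sets lebesgue" if "B \<in> sigma_sets UNIV ?G" for B
      using that unfolding G by (metis sets_completionI_sets sets_lborel)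
    have "Int_stable ?G"
      unfolding Int_stable_def by (auto simp: Int_greaterThanLessThan intro!: image_eqI[where x="(max _ _, min _ _)"])
    then show ?thesis
      using subset_UNIV[of ?G, folded Pow_UNIV] A
    proof (induction rule: sigma_sets_induct_disjoint)
      case (basic B)
      then show ?case using zero by auto
    next
      case empty
      then show ?case by (simp add: set_lebesgue_integral_def)
    next
      case (compl B)
      have B: "B \<in> sets lebesgue" using compl(1) by (rule sb)
      then have "UNIV - B \<in> sets lebesgue" by (metis sets.compl_sets space_completion space_lborel space_borel)
      have "(LINT x:(UNIV - B) \<union> B|lebesgue. f x) = (LINT x:UNIV - B|lebesgue. f x) + (LINT x:B|lebesgue. f x)"
        by (intro set_integral_Un si) (use B \<open>UNIV - B \<in> _\<close> in auto)
      moreover have "(LINT x:(UNIV - B) \<union> B|lebesgue. f x) = 0"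
        using total by (simp add: set_lebesgue_integral_def)
      ultimately show ?case using compl by simp
    next
      case (union B)
      have B: "B i \<in> sets lebesgue" for i using union(2) by (intro sb) auto
      have "(LINT x:(\<Union>i. B i)|lebesgue. f x) = (\<Sum>i. (LINT x:(B i)|lebesgue. f x))"
        using union(1) B by (intro lebesgue_integral_countable_add si) (auto simp: disjoint_family_on_def)
      then show ?case using union(3) by simp
    qed
  qed
  fix A :: "real set" assume "A \<in> sets lebesgue"
  then obtain S N N' where A: "A = S \<union> N" "N \<subseteq> N'" "N' \<in> null_sets lborel" "S \<in> sets lborel"
    by (rule sets_completionE)
  have "AE x in lebesgue. x \<notin> N'"
    using A(3) by (intro AE_not_in) (simp add: null_sets_completionI)
  moreover have "S \<in> sets lebesgue" using A(4) by (rule sets_completionI_sets)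
  ultimately have "(LINT x:A|lebesgue. f x) = (LINT x:S|lebesgue. f x)"
    unfolding set_lebesgue_integral_def using A(1,2) f \<open>A \<in> sets lebesgue\<close>
    by (intro integral_cong_AE borel_measurable_scaleR borel_measurable_indicator)
      (auto elim!: eventually_mono split: split_indicator)
  then show "(LINT x:A|lebesgue. f x) = 0" using borel A(4) by simp
qed

section \<open>Exchange of the order of integration over a triangle\<close>

text \<open>Both sides are iterated integrals of \<open>p y * q x\<close> over the region
  \<open>y < x\<close>. The untruncated product is integrable on the plane and dominates the
  truncated one.\<close>

lemma lebesgue_Fubini_triangle:
  fixes p q :: "real \<Rightarrow> real"
  assumes p: "integrable lebesgue p" and q: "integrable lebesgue q"
  shows "(\<integral>x. (\<integral>y. indicator {..<x} y * p y \<partial>lebesgue) * q x \<partial>lebesgue)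
    = (\<integral>y. p y * (\<integral>x. indicator {y<..} x * q x \<partial>lebesgue) \<partial>lebesgue)"
proof -
  interpret pair_sigma_finite "lebesgue :: real measure" "lebesgue :: real measure"
    by (intro pair_sigma_finite.intro sigma_finite_lebesgue)
  let ?f = "\<lambda>x y. indicator {y<..} x * (p y * q x)"
  have [measurable]: "p \<in> borel_measurable lebesgue" "q \<in> borel_measurable lebesgue" using p q by auto
  have id: "(\<lambda>x. x) \<in> borel_measurable (lebesgue :: real measure)"
    by (rule measurable_completion) simp
  note [measurable] = measurable_compose[OF measurable_fst id] measurable_compose[OF measurable_snd id]
  have pq: "integrable (lebesgue \<Otimes>\<^sub>M lebesgue) (\<lambda>(x, y). p y * q x)"
    by (rule Fubini_integrable) (use p q in \<open>auto simp: abs_mult case_prod_unfold intro!: integrable_mult_left\<close>)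
  have "integrable (lebesgue \<Otimes>\<^sub>M lebesgue) (\<lambda>(x, y). ?f x y)"
  proof (rule Bochner_Integration.integrable_bound[OF pq])
    \<comment> \<open>Unfolded to a comparison of the two coordinates, the indicator of the triangle
      is jointly measurable.\<close>
    have "(\<lambda>z. indicator {snd z<..} (fst z) :: real) \<in> borel_measurable ((lebesgue :: real measure) \<Otimes>\<^sub>M (lebesgue :: real measure))"
      unfolding indicator_def greaterThan_iff by measurable
    then show "(\<lambda>(x, y). ?f x y) \<in> borel_measurable (lebesgue \<Otimes>\<^sub>M lebesgue)"
      unfolding case_prod_unfold by measurable
  qed (auto split: split_indicator)
  from Fubini_integral[OF this]
  have "(\<integral>x. (\<integral>y. ?f x y \<partial>lebesgue) \<partial>lebesgue) = (\<integral>y. (\<integral>x. ?f x y \<partial>lebesgue) \<partial>lebesgue)" by simp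
  moreover have "(\<integral>y. ?f x y \<partial>lebesgue) = (\<integral>y. indicator {..<x} y * p y \<partial>lebesgue) * q x" for x
  proof -
    have "(\<integral>y. ?f x y \<partial>lebesgue) = (\<integral>y. (indicator {..<x} y * p y) * q x \<partial>lebesgue)"
      by (rule Bochner_Integration.integral_cong) (auto split: split_indicator)
    then show ?thesis by (simp only: integral_mult_left_zero)
  qed
  moreover have "(\<integral>x. ?f x y \<partial>lebesgue) = p y * (\<integral>x. indicator {y<..} x * q x \<partial>lebesgue)" for y
  proof -
    have "(\<integral>x. ?f x y \<partial>lebesgue) = (\<integral>x. p y * (indicator {y<..} x * q x) \<partial>lebesgue)"
      by (rule Bochner_Integration.integral_cong) (auto split: split_indicator)
    then show ?thesis by (simp only: integral_mult_right_zero)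
  qed
  ultimately show ?thesis by simp
qed

lemma set_integral_Fubini_triangle:
  fixes p q :: "real \<Rightarrow> real"
  assumes p: "set_integrable lebesgue {0<..<L} p" and q: "set_integrable lebesgue {0<..<L} q"
  shows "(LINT x:{0<..<L}|lebesgue. (LINT y:{0<..<x}|lebesgue. p y) * q x)
    = (LINT y:{0<..<L}|lebesgue. p y * (LINT x:{y<..<L}|lebesgue. q x))"
proof -
  let ?p = "\<lambda>x. indicator {0<..<L} x * p x" and ?q = "\<lambda>x. indicator {0<..<L} x * q x"
  have "(\<integral>x. (\<integral>y. indicator {..<x} y * ?p y \<partial>lebesgue) * ?q x \<partial>lebesgue)
    = (\<integral>y. ?p y * (\<integral>x. indicator {y<..} x * ?q x \<partial>lebesgue) \<partial>lebesgue)"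
    by (rule lebesgue_Fubini_triangle) (use p q in \<open>auto simp: set_integrable_def\<close>)
  moreover have "(\<integral>y. indicator {..<x} y * ?p y \<partial>lebesgue) * ?q x
      = indicator {0<..<L} x *\<^sub>R ((LINT y:{0<..<x}|lebesgue. p y) * q x)" for x
    unfolding set_lebesgue_integral_def
    by (cases "x \<in> {0<..<L}") (auto intro!: Bochner_Integration.integral_cong split: split_indicator)
  moreover have "?p y * (\<integral>x. indicator {y<..} x * ?q x \<partial>lebesgue)
      = indicator {0<..<L} y *\<^sub>R (p y * (LINT x:{y<..<L}|lebesgue. q x))" for y
    unfolding set_lebesgue_integral_def
    by (cases "y \<in> {0<..<L}") (auto intro!: Bochner_Integration.integral_cong split: split_indicator)
  ultimately show ?thesis by (simp add: set_lebesgue_integral_def)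
qed

lemma set_integrable_continuous:
  fixes f :: "real \<Rightarrow> real"
  assumes "continuous_on {a..b} f"
  shows "set_integrable lebesgue {a<..<b} f"
    and "(LINT x:{a<..<b}|lebesgue. f x) = integral {a..b} f"
proof -
  have "f absolutely_integrable_on {a..b}"
    using assms by (rule absolutely_integrable_continuous_real)
  then show *: "set_integrable lebesgue {a<..<b} f"
    by (rule set_integrable_subset) auto
  show "(LINT x:{a<..<b}|lebesgue. f x) = integral {a..b} f"
    using set_lebesgue_integral_eq_integral(2)[OF *] by (simp add: integral_open_interval_real)
qed

lemma set_integrable_mult_continuous:
  fixes h \<psi> :: "real \<Rightarrow> real"
  assumes h: "set_integrable lebesgue {a<..<b} h" and \<psi>: "continuous_on {a..b} \<psi>"
  shows "set_integrable lebesgue {a<..<b} (\<lambda>x. h x * \<psi> x)"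
proof -
  have "set_borel_measurable borel {a<..<b} \<psi>"
    by (rule set_measurable_continuous_on) (auto intro: continuous_on_subset[OF \<psi>])
  then have [measurable]: "(\<lambda>x. indicator {a<..<b} x *\<^sub>R \<psi> x) \<in> borel_measurable lebesgue"
    unfolding set_borel_measurable_def by (intro measurable_completion) simp
  obtain C where C: "\<forall>x\<in>{a..b}. \<bar>\<psi> x\<bar> \<le> C"
    using compact_imp_bounded[OF compact_continuous_image[OF \<psi> compact_Icc]] by (auto simp: bounded_iff)
  have "integrable lebesgue (\<lambda>x. C * (indicator {a<..<b} x * h x))"
    using h by (simp add: set_integrable_def)
  then show ?thesis
    unfolding set_integrable_def
  proof (rule Bochner_Integration.integrable_bound)
    have "(\<lambda>x. (indicator {a<..<b} x *\<^sub>R h x) * (indicator {a<..<b} x *\<^sub>R \<psi> x)) \<in> borel_measurable lebesgue"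
      using h unfolding set_integrable_def by measurable
    then show "(\<lambda>x. indicator {a<..<b} x *\<^sub>R (h x * \<psi> x)) \<in> borel_measurable lebesgue"
      by (rule measurable_cong[THEN iffD1, rotated]) (simp split: split_indicator)
    have "\<bar>h x * \<psi> x\<bar> \<le> \<bar>C * h x\<bar>" if "x \<in> {a<..<b}" for x
      using bspec[OF C, of x] that by (auto simp: abs_mult mult.commute[of "\<bar>h _\<bar>"] intro!: mult_right_mono)
    then show "AE x in lebesgue. norm (indicator {a<..<b} x *\<^sub>R (h x * \<psi> x)) \<le> norm (C * (indicator {a<..<b} x * h x))"
      by (auto split: split_indicator)
  qed
qed

section \<open>Functions with vanishing weak derivative (the du Bois-Reymond lemma)\<close>

text \<open>The primitive of \<open>\<psi>\<close> that vanishes at 0 is constant on either side of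
  the support. The zero mean makes it vanish at \<open>L\<close> too, hence on the right side, so it
  is an admissible test function with derivative \<open>\<psi>\<close>.\<close>

lemma orthogonal_test_function_antiderivative:
  fixes f \<psi> :: "real \<Rightarrow> real"
  assumes f: "\<And>\<phi>. test_function L \<phi> \<Longrightarrow> (LINT x:{0<..<L}|lebesgue. f x * deriv \<phi> x) = 0"
    and \<psi>: "continuous_on UNIV \<psi>" and ab: "0 < a" "a < b" "b < L"
    and supp: "\<And>x. x \<notin> {a..b} \<Longrightarrow> \<psi> x = 0" and mean: "(LINT x:{0<..<L}|lebesgue. \<psi> x) = 0"
  shows "(LINT x:{0<..<L}|lebesgue. f x * \<psi> x) = 0"
proof -
  obtain \<Phi> where \<Phi>: "\<And>x. (\<Phi> has_vector_derivative \<psi> x) (at x)"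
    using einterval_antiderivative[of "-\<infinity>" \<infinity> \<psi>] \<psi> by (auto simp: continuous_on_eq_continuous_at)
  define \<phi> where "\<phi> x = \<Phi> x - \<Phi> 0" for x
  have d: "(\<phi> has_vector_derivative \<psi> x) (at x)" for x
    unfolding \<phi>_def using has_vector_derivative_diff[OF \<Phi> has_vector_derivative_const] by simp
  have \<phi>_diff: "\<phi> y - \<phi> x = integral {x..y} \<psi>" if "x \<le> y" for x y
    using fundamental_theorem_of_calculus[OF that, of \<phi> \<psi>] d
    by (metis has_vector_derivative_at_within integral_unique)
  \<comment> \<open>One statement for both sides: \<open>y \<le> a\<close> gives constancy to the
    left of the support, \<open>b \<le> x\<close> to the right.\<close>
  have flat: "\<phi> y = \<phi> x" if "x \<le> y" "y \<le> a \<or> b \<le> x" for x y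
  proof -
    have "integral {x..y} \<psi> = integral {x<..<y} \<psi>" by (rule integral_open_interval_real)
    also have "\<dots> = integral {x<..<y} (\<lambda>x. 0)"
      by (rule integral_cong) (use supp that in auto)
    finally show ?thesis using \<phi>_diff[OF that(1)] by simp
  qed
  have "\<phi> 0 = 0" by (simp add: \<phi>_def)
  then have "\<phi> L = 0"
    using \<phi>_diff[of 0 L] ab mean set_integrable_continuous(2)[OF continuous_on_subset[OF \<psi>], of 0 L] by simp
  have out: "\<phi> x = 0" if "x \<notin> {a..b}" for x
  proof (cases "x < a")
    case True
    then show ?thesis using flat[of x 0] flat[of 0 x] \<open>\<phi> 0 = 0\<close> ab by (cases "x \<le> 0") auto
  next
    case False
    then show ?thesis using flat[of x L] flat[of L x] \<open>\<phi> L = 0\<close> ab that by (cases "x \<le> L") auto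
  qed
  have cl: "closure {x. \<phi> x \<noteq> 0} \<subseteq> {a..b}"
    using out by (intro closure_minimal) (blast, simp)
  have "test_function L \<phi>"
    unfolding test_function_def
  proof (intro conjI)
    show "\<phi> C1_differentiable_on UNIV"
      using d \<psi> unfolding C1_differentiable_on_def by blast
    show "compact (closure {x. \<phi> x \<noteq> 0})"
      using cl by (meson bounded_closed_interval bounded_subset closed_closure compact_eq_bounded_closed)
    show "closure {x. \<phi> x \<noteq> 0} \<subseteq> {0<..<L}" using cl ab by auto
  qed
  moreover have "deriv \<phi> x = \<psi> x" for x
    using d[of x] by (intro DERIV_imp_deriv) (simp add: has_real_derivative_iff_has_vector_derivative)
  ultimately show ?thesis using f[of \<phi>] by simp
qed

text \<open>A mean-free continuous density is the derivative of a test function. Subtracting a multiple of \<open>\<psi>\<^sub>0\<close>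
  makes any compactly supported density mean-free, and the \<open>B n\<close> increase to the indicator of an interval.\<close>

lemma AE_constant_if_weak_deriv_zero:
  fixes f :: "real \<Rightarrow> real"
  assumes "L > 0" and fi: "set_integrable lebesgue {0<..<L} f"
    and f: "\<And>\<phi>. test_function L \<phi> \<Longrightarrow> (LINT x:{0<..<L}|lebesgue. f x * deriv \<phi> x) = 0"
  shows "\<exists>c. AE x in lebesgue. x \<in> {0<..<L} \<longrightarrow> f x = c"
proof -
  \<comment> \<open>A tent supported in the middle third; it is positive at \<open>L/2\<close>, so
    its integral \<open>I\<close> can be divided by.\<close>
  define \<psi>\<^sub>0 where "\<psi>\<^sub>0 x = max 0 (min (x - L/3) (2*L/3 - x))" for x
  have c0: "continuous_on UNIV \<psi>\<^sub>0" unfolding \<psi>\<^sub>0_def by (intro continuous_intros)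
  define I where "I = (LINT x:{0<..<L}|lebesgue. \<psi>\<^sub>0 x)"
  have "I \<noteq> 0"
  proof
    assume "I = 0"
    then have "integral {0..L} \<psi>\<^sub>0 = 0"
      unfolding I_def by (simp add: set_integrable_continuous(2) continuous_on_subset[OF c0])
    then have "\<forall>x\<in>{0..L}. \<psi>\<^sub>0 x = 0"
      using \<open>L > 0\<close> by (subst (asm) integral_eq_0_iff) (auto simp: \<psi>\<^sub>0_def intro!: continuous_intros)
    then have "\<psi>\<^sub>0 (L/2) = 0" using \<open>L > 0\<close> by simp
    then show False using \<open>L > 0\<close> by (simp add: \<psi>\<^sub>0_def field_simps split: if_splits)
  qed
  \<comment> \<open>This value makes \<open>f - c\<close> orthogonal to
    \<open>\<psi>\<^sub>0\<close>, so correcting a density by multiples of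
    \<open>\<psi>\<^sub>0\<close> does not change its pairing with \<open>f - c\<close>.\<close>
  define c where "c = (LINT x:{0<..<L}|lebesgue. f x * \<psi>\<^sub>0 x) / I"
  define k where "k x = indicator {0<..<L} x * (f x - c)" for x
  have ci: "set_integrable lebesgue {0<..<L} (\<lambda>x. c)"
    by (rule set_integrable_continuous) simp
  have ki: "integrable lebesgue k"
    using set_integral_diff(1)[OF fi ci] unfolding k_def[abs_def] by (simp add: set_integrable_def)
  have orth: "(\<integral>x. k x * \<psi> x \<partial>lebesgue) = 0"
    if \<psi>: "continuous_on UNIV \<psi>" "0 < a" "b < L" "\<And>x. x \<notin> {a..b} \<Longrightarrow> \<psi> x = 0" for \<psi> a b
  proof -
    let ?S = "\<lambda>h. LINT x:{0<..<L}|lebesgue. h x"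
    define J where "J = ?S \<psi>"
    have i1: "set_integrable lebesgue {0<..<L} \<psi>" "set_integrable lebesgue {0<..<L} \<psi>\<^sub>0"
      by (rule set_integrable_continuous(1), rule continuous_on_subset[OF \<psi>(1)], simp,
          rule set_integrable_continuous(1), rule continuous_on_subset[OF c0], simp)
    have "?S (\<lambda>x. \<psi> x - J / I * \<psi>\<^sub>0 x) = ?S \<psi> - J / I * ?S \<psi>\<^sub>0"
      using i1 by (subst set_integral_diff(2)) auto
    also have "\<dots> = 0" using \<open>I \<noteq> 0\<close> by (simp add: J_def I_def)
    finally have mean: "?S (\<lambda>x. \<psi> x - J / I * \<psi>\<^sub>0 x) = 0" .
    \<comment> \<open>The interval is enlarged by \<open>min\<close> and \<open>max\<close> so that
      it also contains the support of \<open>\<psi>\<^sub>0\<close>; this keeps it nondegenerate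
      even if \<open>{a..b}\<close> is empty.\<close>
    have "?S (\<lambda>x. f x * (\<psi> x - J / I * \<psi>\<^sub>0 x)) = 0"
    proof (rule orthogonal_test_function_antiderivative[OF f _ _ _ _ _ mean, where a="min a (L/3)" and b="max b (2*L/3)"])
      show "continuous_on UNIV (\<lambda>x. \<psi> x - J / I * \<psi>\<^sub>0 x)"
        by (intro continuous_intros \<psi>(1) c0)
      fix x assume "x \<notin> {min a (L/3)..max b (2*L/3)}"
      then have "x \<notin> {a..b}" "\<psi>\<^sub>0 x = 0" by (auto simp: \<psi>\<^sub>0_def)
      then show "\<psi> x - J / I * \<psi>\<^sub>0 x = 0" using \<psi>(4) by simp
    qed (use \<psi>(2,3) \<open>L > 0\<close> in auto)
    moreover have "?S (\<lambda>x. f x * (\<psi> x - J / I * \<psi>\<^sub>0 x)) = ?S (\<lambda>x. f x * \<psi> x) - J / I * ?S (\<lambda>x. f x * \<psi>\<^sub>0 x)"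
    proof -
      have "?S (\<lambda>x. f x * (\<psi> x - J / I * \<psi>\<^sub>0 x)) = ?S (\<lambda>x. f x * \<psi> x - J / I * (f x * \<psi>\<^sub>0 x))"
        by (simp add: algebra_simps)
      also have "\<dots> = ?S (\<lambda>x. f x * \<psi> x) - ?S (\<lambda>x. J / I * (f x * \<psi>\<^sub>0 x))"
        by (intro set_integral_diff(2) set_integrable_mult_right set_integrable_mult_continuous[OF fi continuous_on_subset[OF \<psi>(1) subset_UNIV]] set_integrable_mult_continuous[OF fi continuous_on_subset[OF c0 subset_UNIV]])
      finally show ?thesis by simp
    qed
    ultimately have "?S (\<lambda>x. f x * \<psi> x) = c * J" by (simp add: c_def I_def)
    moreover have "?S (\<lambda>x. f x * \<psi> x - c * \<psi> x) = ?S (\<lambda>x. f x * \<psi> x) - ?S (\<lambda>x. c * \<psi> x)"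
      by (intro set_integral_diff(2) set_integrable_mult_continuous[OF fi continuous_on_subset[OF \<psi>(1) subset_UNIV]] set_integrable_mult_right i1)
    moreover have "?S (\<lambda>x. f x * \<psi> x - c * \<psi> x) = (\<integral>x. k x * \<psi> x \<partial>lebesgue)"
      unfolding set_lebesgue_integral_def k_def
      by (rule Bochner_Integration.integral_cong) (auto simp: algebra_simps split: split_indicator)
    ultimately show ?thesis by (simp add: J_def)
  qed
  have "(LINT x:{\<alpha>'<..<\<beta>'}|lebesgue. k x) = 0" for \<alpha>' \<beta>'
  proof -
    \<comment> \<open>Clipping to the interval from 0 to \<open>L\<close> is harmless since
      \<open>k\<close> vanishes outside it.\<close>
    define \<alpha> \<beta> where "\<alpha> = max 0 \<alpha>'" and "\<beta> = min L \<beta>'"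
    \<comment> \<open>Trapezoids bounded by 1. They vanish within distance \<open>1 / Suc n\<close>
      of the end points, which keeps the support away from 0 and \<open>L\<close>, and equal 1 from
      distance \<open>2 / Suc n\<close> on.\<close>
    define B where "B n x = min 1 (max 0 (real (Suc n) * min (x - \<alpha>) (\<beta> - x) - 1))" for n x
    have B_cont: "continuous_on UNIV (B n)" for n unfolding B_def by (intro continuous_intros)
    have zero: "(\<integral>x. k x * B n x \<partial>lebesgue) = 0" for n
    proof (rule orth[where a = "\<alpha> + 1 / Suc n" and b = "\<beta> - 1 / Suc n"])
      show "continuous_on UNIV (B n)" by (rule B_cont)
      show "0 < \<alpha> + 1 / Suc n" by (simp add: \<alpha>_def add_nonneg_pos)
      show "\<beta> - 1 / Suc n < L" 
      proof -
        have "1 / real (Suc n) > 0" "\<beta> \<le> L" by (simp_all add: \<beta>_def)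
        then show ?thesis by linarith
      qed
      show "B n x = 0" if "x \<notin> {\<alpha> + 1 / Suc n..\<beta> - 1 / Suc n}" for x
      proof -
        have "min (x - \<alpha>) (\<beta> - x) \<le> 1 / Suc n" using that by auto
        then have "real (Suc n) * min (x - \<alpha>) (\<beta> - x) \<le> real (Suc n) * (1 / Suc n)"
          by (intro mult_left_mono) auto
        then show ?thesis by (simp add: B_def)
      qed
    qed
    have lim: "(\<lambda>n. B n x) \<longlonglongrightarrow> indicator {\<alpha><..<\<beta>} x" for x
    proof (cases "x \<in> {\<alpha><..<\<beta>}")
      case True
      then have m: "min (x - \<alpha>) (\<beta> - x) > 0" by simp
      obtain N :: nat where N: "2 / min (x - \<alpha>) (\<beta> - x) < N" using reals_Archimedean2 by blast
      have "B n x = 1" if "n \<ge> N" for n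
      proof -
        have "2 / min (x - \<alpha>) (\<beta> - x) \<le> Suc n" using N that by linarith
        then have "2 \<le> real (Suc n) * min (x - \<alpha>) (\<beta> - x)" using m by (simp only: pos_divide_le_eq)
        then show ?thesis by (simp add: B_def)
      qed
      then have "\<forall>\<^sub>F n in sequentially. B n x = indicator {\<alpha><..<\<beta>} x"
        using True by (auto simp: eventually_sequentially intro!: exI[of _ N])
      then show ?thesis by (rule tendsto_eventually)
    next
      case False
      then have "min (x - \<alpha>) (\<beta> - x) \<le> 0" by auto
      then have "real (Suc n) * min (x - \<alpha>) (\<beta> - x) \<le> 0" for n
        by (intro mult_nonneg_nonpos) auto
      moreover have "min 1 (max 0 (y - 1)) = 0" if "y \<le> 0" for y :: real using that by simp
      ultimately have "B n x = 0" for n unfolding B_def by blast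
      then show ?thesis using False by simp
    qed
    have "(\<lambda>n. \<integral>x. k x * B n x \<partial>lebesgue) \<longlonglongrightarrow> (\<integral>x. k x * indicator {\<alpha><..<\<beta>} x \<partial>lebesgue)"
    proof (rule integral_dominated_convergence[where w = "\<lambda>x. \<bar>k x\<bar>"])
      show "integrable lebesgue (\<lambda>x. \<bar>k x\<bar>)" using ki by simp
      show "(\<lambda>x. k x * indicator {\<alpha><..<\<beta>} x) \<in> borel_measurable lebesgue"
        using ki by (intro borel_measurable_times borel_measurable_indicator) auto
      have B_meas: "B n \<in> borel_measurable lebesgue" for n
        by (rule measurable_completion) (simp add: borel_measurable_continuous_onI[OF B_cont])
      show "(\<lambda>x. k x * B n x) \<in> borel_measurable lebesgue" for n
        using ki by (intro borel_measurable_times B_meas) simp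
      show "AE x in lebesgue. (\<lambda>n. k x * B n x) \<longlonglongrightarrow> k x * indicator {\<alpha><..<\<beta>} x"
        using lim by (intro AE_I2 tendsto_mult tendsto_const)
      have "\<bar>B n x\<bar> \<le> 1" for n x by (simp add: B_def)
      then show "AE x in lebesgue. norm (k x * B n x) \<le> \<bar>k x\<bar>" for n
        by (auto simp: abs_mult intro!: mult_left_le)
    qed
    then have "(\<integral>x. k x * indicator {\<alpha><..<\<beta>} x \<partial>lebesgue) = 0"
      using zero by (simp add: LIMSEQ_const_iff)
    moreover have "k x * indicator {\<alpha><..<\<beta>} x = indicator {\<alpha>'<..<\<beta>'} x *\<^sub>R k x" for x
      by (auto simp: k_def \<alpha>_def \<beta>_def split: split_indicator)
    ultimately show ?thesis by (simp add: set_lebesgue_integral_def)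
  qed
  then have "AE x in lebesgue. k x = 0"
    by (intro AE_eq_0_if_interval_integrals_eq_0[OF ki, of 0 L]) (auto simp: k_def)
  then show ?thesis by (intro exI[of _ c]) (auto simp: k_def elim!: eventually_mono)
qed

subsection \<open>The spaces \<open>L\<^sup>2(0,L)\<close> and \<open>H\<^sup>1(0,L)\<close>\<close>

lemma sq_integrable_rep_l2: "sq_integrable (rep_l2 f)"
  using Quotient3_rel_rep[OF Quotient3_l2, of f f] by (simp add: l2_rel_def)

lemma AE_rep_abs_l2: "sq_integrable f \<Longrightarrow> AE x in lebesgue. rep_l2 (abs_l2 f) x = f x"
  using Quotient3_rep_abs[OF Quotient3_l2, of f] by (simp add: l2_rel_def)

lemma l2_eqI: "(AE x in lebesgue. rep_l2 f x = rep_l2 g x) \<Longrightarrow> f = g"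
  using Quotient3_rel_rep[OF Quotient3_l2, of f g] by (simp add: l2_rel_def sq_integrable_rep_l2)

lemma AE_rep_diff_l2: "AE x in lebesgue. rep_l2 (f - g) x = rep_l2 f x - rep_l2 g x"
  unfolding minus_l2_def by (simp add: AE_rep_abs_l2 sq_integrable_diff sq_integrable_rep_l2)

lemma AE_rep_scale_l2: "AE x in lebesgue. rep_l2 (c *\<^sub>R f) x = c * rep_l2 f x"
  unfolding scaleR_l2_def by (simp add: AE_rep_abs_l2 sq_integrable_scale sq_integrable_rep_l2)

lemma AE_rep_zero_l2: "AE x in lebesgue. rep_l2 0 x = 0"
  unfolding zero_l2_def by (simp add: AE_rep_abs_l2 sq_integrable_zero)

lemma inner_l2_eq: "inner f g = (\<integral>x. rep_l2 f x * rep_l2 g x \<partial>lebesgue)"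
  unfolding inner_l2_def by (simp add: map_fun_def)

definition l2_restrict :: "real \<Rightarrow> (real \<Rightarrow> real) \<Rightarrow> l2" where
  "l2_restrict L h = abs_l2 (\<lambda>x. indicator {0<..<L} x * h x)"

lemma sq_integrable_restrict:
  assumes "continuous_on {0..L} h"
  shows "sq_integrable (\<lambda>x. indicator {0<..<L} x * h x)"
proof -
  have "set_integrable lebesgue {0<..<L} h" "set_integrable lebesgue {0<..<L} (\<lambda>x. (h x)\<^sup>2)"
    using assms by (auto intro!: set_integrable_continuous continuous_intros)
  moreover have "(indicator {0<..<L} x * h x)\<^sup>2 = indicator {0<..<L} x * (h x)\<^sup>2" for x
    by (simp split: split_indicator)
  ultimately show ?thesis
    by (auto simp: sq_integrable_def set_integrable_def)
qed

lemma AE_rep_restrict: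
  "continuous_on {0..L} h \<Longrightarrow> AE x in lebesgue. rep_l2 (l2_restrict L h) x = indicator {0<..<L} x * h x"
  unfolding l2_restrict_def by (intro AE_rep_abs_l2 sq_integrable_restrict)

lemma borel_measurable_rep_l2 [measurable]: "rep_l2 f \<in> borel_measurable lebesgue"
  using sq_integrable_rep_l2[of f] by (simp add: sq_integrable_def)

lemma inner_restrict:
  assumes "continuous_on {0..L} h"
  shows "inner f (l2_restrict L h) = (LINT x:{0<..<L}|lebesgue. rep_l2 f x * h x)"
  unfolding inner_l2_eq set_lebesgue_integral_def
proof (rule integral_cong_AE)
  have "(\<lambda>x. rep_l2 f x * (indicator {0<..<L} x * h x)) \<in> borel_measurable lebesgue"
    using sq_integrable_restrict[OF assms] by (auto simp: sq_integrable_def)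
  then show "(\<lambda>x. indicator {0<..<L} x *\<^sub>R (rep_l2 f x * h x)) \<in> borel_measurable lebesgue"
    by (simp add: mult.left_commute)
  show "AE x in lebesgue. rep_l2 f x * rep_l2 (l2_restrict L h) x = indicator {0<..<L} x *\<^sub>R (rep_l2 f x * h x)"
    using AE_rep_restrict[OF assms] by eventually_elim simp
qed measurable

lemma set_integrable_rep_l2: "set_integrable lebesgue {0<..<L} (rep_l2 f)"
  using sq_integrable_mult[OF sq_integrable_restrict[of L "\<lambda>_. 1"] sq_integrable_rep_l2[of f]]
  by (simp add: set_integrable_def)

lemma primitive_continuous:
  fixes p :: "real \<Rightarrow> real"
  assumes "set_integrable lebesgue {0<..<L} p"
  shows "continuous_on {0..L} (\<lambda>x. LINT y:{0<..<x}|lebesgue. p y)"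
proof -
  have "p integrable_on {0<..<L}" using set_lebesgue_integral_eq_integral(1)[OF assms] .
  then have "p integrable_on {0..L}" by (simp add: integrable_on_Icc_iff_Ioo)
  then have "continuous_on {0..L} (\<lambda>x. integral {0..x} p)" by (rule indefinite_integral_continuous_1)
  moreover have "integral {0..x} p = (LINT y:{0<..<x}|lebesgue. p y)" if "x \<in> {0..L}" for x
  proof -
    have "set_integrable lebesgue {0<..<x} p"
      using that by (intro set_integrable_subset[OF assms]) auto
    then show ?thesis by (simp add: set_lebesgue_integral_eq_integral(2) integral_open_interval_real)
  qed
  ultimately show ?thesis by (rule continuous_on_eq)
qed

lemma set_integral_split_Ioo:
  fixes p :: "real \<Rightarrow> real"
  assumes p: "set_integrable lebesgue {0<..<L} p" and "0 \<le> y" "y \<le> z" "z \<le> L"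
  shows "(LINT x:{y<..<z}|lebesgue. p x) = (LINT x:{0<..<z}|lebesgue. p x) - (LINT x:{0<..<y}|lebesgue. p x)"
proof -
  have i: "set_integrable lebesgue {y<..<z} p" "set_integrable lebesgue {0<..<y} p" "set_integrable lebesgue {0<..<z} p"
    using assms by (auto intro: set_integrable_subset)
  have "(LINT x:{0<..<z}|lebesgue. p x) = (LINT x:{0<..<y} \<union> {y<..<z}|lebesgue. p x)"
  proof (rule set_integral_cong_set)
    have "AE x in lebesgue. x \<noteq> y" by (intro AE_completion AE_lborel_singleton)
    then show "AE x in lebesgue. (x \<in> {0<..<y} \<union> {y<..<z}) = (x \<in> {0<..<z})"
      using assms by (auto elim!: eventually_mono)
    show "set_borel_measurable lebesgue ({0<..<y} \<union> {y<..<z}) p"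
      using set_integrable_Un[OF i(2,1)] by (simp add: set_integrable_def set_borel_measurable_def)
  qed (use i(3) in \<open>simp add: set_integrable_def set_borel_measurable_def\<close>)
  also have "\<dots> = (LINT x:{0<..<y}|lebesgue. p x) + (LINT x:{y<..<z}|lebesgue. p x)"
    using i by (intro set_integral_Un) auto
  finally show ?thesis by simp
qed

section \<open>Continuous representatives, traces and uniqueness of the weak derivative\<close>

text \<open>The set of disagreement in the open interval is open and null, hence empty; continuity
  carries the equality to the end points. This makes the definite description in
  \<open>pt_val\<close> independent of the representative.\<close>

lemma continuous_AE_eq:
  fixes h k :: "real \<Rightarrow> real"
  assumes "L > 0" "continuous_on {0..L} h" "continuous_on {0..L} k"
    and ae: "AE x in lebesgue. x \<in> {0<..<L} \<longrightarrow> h x = k x" and "x \<in> {0..L}"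
  shows "h x = k x"
proof -
  let ?d = "\<lambda>x. h x - k x"
  have c: "continuous_on {0..L} ?d" using assms by (intro continuous_intros)
  let ?S = "{0<..<L} \<inter> ?d -` (- {0})"
  have "open ?S"
    by (rule continuous_open_preimage) (auto intro: continuous_on_subset[OF c])
  moreover have "?S \<in> null_sets lebesgue"
  proof (subst AE_iff_null_sets)
    show "?S \<in> sets lebesgue" using \<open>open ?S\<close> by (simp add: borel_open sets_completionI_sets)
    show "AE x in lebesgue. x \<notin> ?S" using ae by eventually_elim auto
  qed
  ultimately have "?S = {}" using open_not_negligible negligible_iff_null_sets by blast
  then have "\<And>y. y \<in> {0<..<L} \<Longrightarrow> ?d y = 0" by blast
  moreover have "closure {0<..<L} = {0..L}" using \<open>L > 0\<close> by simp
  ultimately have "?d x = 0"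
    using continuous_constant_on_closure[of "{0<..<L}" ?d 0 x] c assms(5) by simp
  then show ?thesis by simp
qed

lemma pt_val_eq:
  assumes "L > 0" "continuous_on {0..L} h" "AE y in lebesgue. y \<in> {0<..<L} \<longrightarrow> rep_l2 u y = h y" "x \<in> {0..L}"
  shows "pt_val L u x = h x"
  unfolding pt_val_def
proof (rule the_equality)
  fix a assume "\<exists>k. continuous_on {0..L} k \<and> (AE y in lebesgue. y \<in> {0<..<L} \<longrightarrow> rep_l2 u y = k y) \<and> a = k x"
  then obtain k where k: "continuous_on {0..L} k" "AE y in lebesgue. y \<in> {0<..<L} \<longrightarrow> rep_l2 u y = k y" "a = k x"
    by blast
  have "AE y in lebesgue. y \<in> {0<..<L} \<longrightarrow> k y = h y" using k(2) assms(3) by eventually_elim auto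
  then show "a = h x" using continuous_AE_eq[OF assms(1) k(1) assms(2) _ assms(4)] k(3) by simp
qed (use assms in blast)

lemma test_functionE:
  assumes "test_function L \<phi>"
  obtains D where "\<forall>x. (\<phi> has_vector_derivative D x) (at x)" "continuous_on UNIV D" "deriv \<phi> = D" "\<phi> 0 = 0" "\<phi> L = 0"
proof -
  obtain D where D: "\<forall>x. (\<phi> has_vector_derivative D x) (at x)" "continuous_on UNIV D"
    using assms unfolding test_function_def C1_differentiable_on_def by auto
  have "deriv \<phi> x = D x" for x
    using D(1)[rule_format, of x] by (intro DERIV_imp_deriv) (simp add: has_real_derivative_iff_has_vector_derivative)
  moreover have "\<phi> 0 = 0" "\<phi> L = 0"
    using assms closure_subset[of "{x. \<phi> x \<noteq> 0}"] unfolding test_function_def by fastforce+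
  ultimately show ?thesis using D that by blast
qed

text \<open>Integration by parts through Fubini on the triangle: after the exchange, the inner
  integral of \<open>deriv \<phi>\<close> from \<open>y\<close> to \<open>L\<close> is
  \<open>- \<phi> y\<close>, because \<open>\<phi> L = 0\<close>.\<close>

lemma primitive_weak_deriv:
  assumes p: "set_integrable lebesgue {0<..<L} p" and \<phi>: "test_function L \<phi>"
  shows "(LINT x:{0<..<L}|lebesgue. (LINT y:{0<..<x}|lebesgue. p y) * deriv \<phi> x)
    = - (LINT x:{0<..<L}|lebesgue. p x * \<phi> x)"
proof -
  obtain D where D: "\<forall>x. (\<phi> has_vector_derivative D x) (at x)" "continuous_on UNIV D" "deriv \<phi> = D" "\<phi> 0 = 0" "\<phi> L = 0"
    using \<phi> by (rule test_functionE)
  have iD: "set_integrable lebesgue {0<..<L} D"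
    by (rule set_integrable_continuous(1)) (rule continuous_on_subset[OF D(2) subset_UNIV])
  have D\<phi>: "(LINT x:{y<..<L}|lebesgue. D x) = - \<phi> y" if "y \<in> {0<..<L}" for y
  proof -
    have "(LINT x:{y<..<L}|lebesgue. D x) = integral {y..L} D"
      by (rule set_integrable_continuous(2)) (rule continuous_on_subset[OF D(2) subset_UNIV])
    also have "(D has_integral \<phi> L - \<phi> y) {y..L}"
      using that D(1) by (intro fundamental_theorem_of_calculus) (auto intro: has_vector_derivative_at_within)
    then have "integral {y..L} D = - \<phi> y" using D(5) by (simp add: integral_unique)
    finally show ?thesis .
  qed
  have "(LINT x:{0<..<L}|lebesgue. (LINT y:{0<..<x}|lebesgue. p y) * D x)
      = (LINT y:{0<..<L}|lebesgue. p y * (LINT x:{y<..<L}|lebesgue. D x))"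
    by (rule set_integral_Fubini_triangle[OF p iD])
  also have "\<dots> = (LINT y:{0<..<L}|lebesgue. - (p y * \<phi> y))"
    using D\<phi> by (intro set_lebesgue_integral_cong) auto
  finally show ?thesis using D(3) by (simp add: set_lebesgue_integral_def)
qed

abbreviation primitive :: "l2 \<Rightarrow> real \<Rightarrow> real" where
  "primitive w x \<equiv> (LINT y:{0<..<x}|lebesgue. rep_l2 w y)"

lemmas primitive_rep_continuous = primitive_continuous[OF set_integrable_rep_l2]

text \<open>Subtracting the primitive of \<open>w\<close> from \<open>u\<close> leaves a function
  with zero weak derivative, that is, a constant. The primitive vanishes at 0, so the constant is
  the trace there.\<close>

lemma H1_AE_eq:
  assumes "L > 0" and H1: "(u, w) \<in> H1 L"
  shows "AE x in lebesgue. x \<in> {0<..<L} \<longrightarrow> rep_l2 u x = pt_val L u 0 + primitive w x"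
proof -
  let ?P = "primitive w"
  have iP: "set_integrable lebesgue {0<..<L} ?P"
    by (rule set_integrable_continuous(1)[OF primitive_rep_continuous])
  have "\<exists>c. AE x in lebesgue. x \<in> {0<..<L} \<longrightarrow> rep_l2 u x - ?P x = c"
  proof (rule AE_constant_if_weak_deriv_zero[OF \<open>L > 0\<close>])
    show "set_integrable lebesgue {0<..<L} (\<lambda>x. rep_l2 u x - ?P x)"
      by (intro set_integral_diff set_integrable_rep_l2 iP)
    fix \<phi> assume \<phi>: "test_function L \<phi>"
    obtain D where D: "continuous_on UNIV D" "deriv \<phi> = D"
      using \<phi> by (elim test_functionE)
    have c: "continuous_on {0..L} D" by (rule continuous_on_subset[OF D(1) subset_UNIV])
    have "(LINT x:{0<..<L}|lebesgue. (rep_l2 u x - ?P x) * deriv \<phi> x)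
        = (LINT x:{0<..<L}|lebesgue. rep_l2 u x * D x) - (LINT x:{0<..<L}|lebesgue. ?P x * D x)"
      unfolding left_diff_distrib D(2)
      by (intro set_integral_diff(2) set_integrable_mult_continuous[OF _ c] set_integrable_rep_l2 iP)
    then show "(LINT x:{0<..<L}|lebesgue. (rep_l2 u x - ?P x) * deriv \<phi> x) = 0"
      using H1 \<phi> primitive_weak_deriv[OF set_integrable_rep_l2 \<phi>, of w] D(2)
      by (auto simp: H1_def weak_deriv_def)
  qed
  then obtain c where c: "AE x in lebesgue. x \<in> {0<..<L} \<longrightarrow> rep_l2 u x = c + ?P x"
    by (auto simp: algebra_simps)
  have "pt_val L u 0 = c + ?P 0"
    using \<open>L > 0\<close> by (intro pt_val_eq c) (auto intro!: continuous_intros primitive_rep_continuous)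
  then show ?thesis using c by (simp add: set_lebesgue_integral_def)
qed

text \<open>The primitives of \<open>w\<close> and \<open>w'\<close> are both \<open>u\<close> minus
  its trace, so they agree almost everywhere and, by continuity, everywhere. Hence
  \<open>w - w'\<close> has zero integral over every subinterval. This justifies the definite
  description in \<open>dx\<close>.\<close>

lemma H1_unique:
  assumes "L > 0" and H1: "(u, w) \<in> H1 L" "(u, w') \<in> H1 L"
  shows "w = w'"
proof -
  let ?k = "\<lambda>x. indicator {0<..<L} x * (rep_l2 w x - rep_l2 w' x)"
  have P: "primitive w x = primitive w' x" if "x \<in> {0..L}" for x
  proof -
    have "pt_val L u 0 + primitive w x = pt_val L u 0 + primitive w' x"
    proof (rule continuous_AE_eq[OF \<open>L > 0\<close> _ _ _ that])
      show "AE x in lebesgue. x \<in> {0<..<L} \<longrightarrow> pt_val L u 0 + primitive w x = pt_val L u 0 + primitive w' x"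
        using H1_AE_eq[OF \<open>L > 0\<close> H1(1)] H1_AE_eq[OF \<open>L > 0\<close> H1(2)] by eventually_elim auto
    qed (intro continuous_intros primitive_rep_continuous)+
    then show ?thesis by simp
  qed
  have i: "set_integrable lebesgue {0<..<L} (\<lambda>x. rep_l2 w x - rep_l2 w' x)"
    by (intro set_integral_diff set_integrable_rep_l2)
  have I: "(LINT x:{y<..<z}|lebesgue. rep_l2 w x - rep_l2 w' x) = 0" if yz: "0 \<le> y" "z \<le> L" for y z
  proof (cases "y \<le> z")
    case True
    have "(LINT x:{y<..<z}|lebesgue. rep_l2 w x - rep_l2 w' x)
        = (LINT x:{y<..<z}|lebesgue. rep_l2 w x) - (LINT x:{y<..<z}|lebesgue. rep_l2 w' x)"
      by (intro set_integral_diff(2) set_integrable_subset[OF set_integrable_rep_l2[of L]]) (use yz in auto)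
    also have "\<dots> = (primitive w z - primitive w y) - (primitive w' z - primitive w' y)"
      by (intro arg_cong2[where f = minus] set_integral_split_Ioo[OF set_integrable_rep_l2[of L]]) (use yz True in auto)
    also have "\<dots> = 0" using P[of y] P[of z] yz True by simp
    finally show ?thesis .
  qed (simp add: set_lebesgue_integral_def)
  have "AE x in lebesgue. ?k x = 0"
  proof (rule AE_eq_0_if_interval_integrals_eq_0[of _ 0 L])
    show "integrable lebesgue ?k" using i by (simp add: set_integrable_def)
    fix a b
    let ?I = "{max 0 a<..<min L b}"
    have "(LINT x:{a<..<b}|lebesgue. ?k x) = (LINT x:?I|lebesgue. rep_l2 w x - rep_l2 w' x)"
      unfolding set_lebesgue_integral_def
      by (rule Bochner_Integration.integral_cong) (auto split: split_indicator)
    also have "\<dots> = 0" by (rule I) simp_all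
    finally show "(LINT x:{a<..<b}|lebesgue. ?k x) = 0" .
  qed auto
  \<comment> \<open>Elements of \<open>l2\<close> live on the whole line; outside the interval both
    derivatives vanish by membership in \<open>L2 L\<close>.\<close>
  moreover have "AE x in lebesgue. x \<notin> {0<..<L} \<longrightarrow> rep_l2 w x = 0" "AE x in lebesgue. x \<notin> {0<..<L} \<longrightarrow> rep_l2 w' x = 0"
    using H1 by (auto simp: H1_def L2_def)
  ultimately have "AE x in lebesgue. rep_l2 w x = rep_l2 w' x"
    by eventually_elim (auto split: split_indicator_asm)
  then show ?thesis by (rule l2_eqI)
qed

lemma dx_eq: "L > 0 \<Longrightarrow> (u, w) \<in> H1 L \<Longrightarrow> dx L u = w"
  unfolding dx_def by (rule the_equality) (assumption, metis H1_unique)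

abbreviation unit_fun :: "real \<Rightarrow> l2" where
  "unit_fun L \<equiv> l2_restrict L (\<lambda>_. 1)"

lemma norm_unit_fun: "L \<ge> 0 \<Longrightarrow> norm (unit_fun L) = sqrt L"
proof -
  assume "L \<ge> 0"
  have "inner (unit_fun L) (unit_fun L) = (\<integral>x. indicator {0<..<L} x * 1 \<partial>lebesgue)"
    unfolding inner_l2_eq
  proof (rule integral_cong_AE)
    show "AE x in lebesgue. rep_l2 (unit_fun L) x * rep_l2 (unit_fun L) x = indicator {0<..<L} x * 1"
      using AE_rep_restrict[of L "\<lambda>_. 1", OF continuous_on_const] by (auto elim!: eventually_mono split: split_indicator)
  qed (auto intro!: borel_measurable_times borel_measurable_indicator)
  also have "\<dots> = L" using \<open>L \<ge> 0\<close> by simp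
  finally show ?thesis by (simp add: norm_eq_sqrt_inner)
qed

text \<open>Testing against \<open>\<phi>\<close> gives \<open>c * (\<phi> L - \<phi> 0)\<close>,
  which is zero. The case \<open>c = 0\<close> also settles the traces and the derivative of the
  zero function.\<close>

lemma const_H1:
  assumes "L > 0"
  shows "(c *\<^sub>R unit_fun L, 0) \<in> H1 L" and "x \<in> {0..L} \<Longrightarrow> pt_val L (c *\<^sub>R unit_fun L) x = c"
proof -
  have ae: "AE x in lebesgue. rep_l2 (c *\<^sub>R unit_fun L) x = indicator {0<..<L} x * c"
    using AE_rep_scale_l2[of c "unit_fun L"] AE_rep_restrict[of L "\<lambda>_. 1", OF continuous_on_const] by eventually_elim simp
  show "pt_val L (c *\<^sub>R unit_fun L) x = c" if "x \<in> {0..L}"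
    using ae that by (intro pt_val_eq[OF assms]) (auto elim!: eventually_mono)
  have "weak_deriv L (c *\<^sub>R unit_fun L) 0"
    unfolding weak_deriv_def
  proof (intro allI impI)
    fix \<phi> assume "test_function L \<phi>"
    then obtain D where D: "\<forall>x. (\<phi> has_vector_derivative D x) (at x)" "continuous_on UNIV D" "deriv \<phi> = D" "\<phi> 0 = 0" "\<phi> L = 0"
      by (rule test_functionE)
    have cD: "continuous_on {0..L} D" by (rule continuous_on_subset[OF D(2) subset_UNIV])
    have c\<phi>: "continuous_on {0..L} \<phi>"
      using D(1) by (intro continuous_at_imp_continuous_on) (auto dest: has_vector_derivative_continuous)
    have "(LINT x:{0<..<L}|lebesgue. rep_l2 (c *\<^sub>R unit_fun L) x * D x) = (LINT x:{0<..<L}|lebesgue. c * D x)"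
      unfolding set_lebesgue_integral_def
    proof (rule integral_cong_AE)
      show "AE x in lebesgue. indicator {0<..<L} x *\<^sub>R (rep_l2 (c *\<^sub>R unit_fun L) x * D x) = indicator {0<..<L} x *\<^sub>R (c * D x)"
        using ae by eventually_elim (auto split: split_indicator)
      show "(\<lambda>x. indicator {0<..<L} x *\<^sub>R (rep_l2 (c *\<^sub>R unit_fun L) x * D x)) \<in> borel_measurable lebesgue"
        using set_integrable_mult_continuous[OF set_integrable_rep_l2 cD] by (simp add: set_integrable_def)
      show "(\<lambda>x. indicator {0<..<L} x *\<^sub>R (c * D x)) \<in> borel_measurable lebesgue"
        using set_integrable_continuous(1)[OF continuous_on_mult_left[OF cD, of c]]
        by (simp add: set_integrable_def)
    qed
    also have "\<dots> = c * integral {0..L} D"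
      by (simp add: set_integrable_continuous(2)[OF cD])
    also have "(D has_integral \<phi> L - \<phi> 0) {0..L}"
      using assms D(1) by (intro fundamental_theorem_of_calculus) (auto intro: has_vector_derivative_at_within)
    then have "integral {0..L} D = 0" using D(4,5) by (simp add: integral_unique)
    finally have "(LINT x:{0<..<L}|lebesgue. rep_l2 (c *\<^sub>R unit_fun L) x * D x) = 0" by simp
    moreover have "(LINT x:{0<..<L}|lebesgue. rep_l2 0 x * \<phi> x) = 0"
      using inner_restrict[OF c\<phi>, of 0] by simp
    ultimately show "(LINT x:{0<..<L}|lebesgue. rep_l2 (c *\<^sub>R unit_fun L) x * deriv \<phi> x)
        = - (LINT x:{0<..<L}|lebesgue. rep_l2 0 x * \<phi> x)" using D(3) by simp
  qed
  moreover have "c *\<^sub>R unit_fun L \<in> L2 L" using ae by (auto simp: L2_def elim!: eventually_mono)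
  moreover have "0 \<in> L2 L" using AE_rep_zero_l2 by (auto simp: L2_def elim!: eventually_mono)
  ultimately show "(c *\<^sub>R unit_fun L, 0) \<in> H1 L" by (simp add: H1_def)
qed

section \<open>Poincare inequality and integration by parts\<close>

text \<open>Cauchy-Schwarz against the indicator of the interval from 0 to \<open>x\<close>, whose
  norm is \<open>sqrt x\<close>.\<close>

lemma primitive_bound: "x \<ge> 0 \<Longrightarrow> \<bar>primitive w x\<bar> \<le> sqrt x * norm w"
  using Cauchy_Schwarz_ineq2[of w "unit_fun x"] inner_restrict[of x "\<lambda>_. 1" w] by (simp add: norm_unit_fun mult.commute)

text \<open>By the previous bound, the square of \<open>u - u(0)\<close> is at most
  \<open>L * (norm w)\<^sup>2\<close> almost everywhere in the interval; integrating over length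
  \<open>L\<close> gives the second factor \<open>L\<close>.\<close>

lemma H1_Poincare:
  assumes "L > 0" and H1: "(u, w) \<in> H1 L"
  shows "norm (u - pt_val L u 0 *\<^sub>R unit_fun L) \<le> L * norm w"
proof -
  let ?a = "pt_val L u 0"
  let ?d = "u - ?a *\<^sub>R unit_fun L"
  have "(norm ?d)\<^sup>2 = (\<integral>x. (rep_l2 ?d x)\<^sup>2 \<partial>lebesgue)" by (rule norm_l2_square)
  also have "\<dots> \<le> (\<integral>x. indicator {0<..<L} x * (L * (norm w)\<^sup>2) \<partial>lebesgue)"
  proof (rule integral_mono_AE)
    show "integrable lebesgue (\<lambda>x. (rep_l2 ?d x)\<^sup>2)"
      using sq_integrable_rep_l2[of ?d] by (simp add: sq_integrable_def)
    show "integrable lebesgue (\<lambda>x. indicator {0<..<L} x * (L * (norm w)\<^sup>2))"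
      using set_integrable_continuous(1)[of 0 L "\<lambda>_. L * (norm w)\<^sup>2"] by (simp add: set_integrable_def)
    have "AE x in lebesgue. x \<notin> {0<..<L} \<longrightarrow> rep_l2 u x = 0" using H1 by (auto simp: H1_def L2_def)
    then show "AE x in lebesgue. (rep_l2 ?d x)\<^sup>2 \<le> indicator {0<..<L} x * (L * (norm w)\<^sup>2)"
      using H1_AE_eq[OF assms] AE_rep_diff_l2[of u "?a *\<^sub>R unit_fun L"] AE_rep_scale_l2[of ?a "unit_fun L"]
        AE_rep_restrict[of L "\<lambda>_. 1", OF continuous_on_const]
    proof eventually_elim
      case (elim x)
      show ?case
      proof (cases "x \<in> {0<..<L}")
        case True
        then have "rep_l2 ?d x = primitive w x" using elim by simp
        moreover have "\<bar>primitive w x\<bar>\<^sup>2 \<le> (sqrt x * norm w)\<^sup>2"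
          using True by (intro power_mono primitive_bound) auto
        moreover have "(sqrt x * norm w)\<^sup>2 \<le> L * (norm w)\<^sup>2"
          using True by (auto simp: power_mult_distrib intro!: mult_right_mono)
        ultimately show ?thesis using True by simp
      qed (use elim in simp)
    qed
  qed
  also have "\<dots> = (L * norm w)\<^sup>2"
    using \<open>L > 0\<close> by (simp add: power2_eq_square)
  finally show ?thesis using \<open>L > 0\<close> by (auto intro: power2_le_imp_le)
qed

text \<open>The function \<open>y \<mapsto> \<integral>\<^sub>y\<^sup>L \<psi>\<close>.\<close>

definition integral_above :: "real \<Rightarrow> l2 \<Rightarrow> l2" where
  "integral_above L \<psi> = l2_restrict L (\<lambda>y. primitive \<psi> L - primitive \<psi> y)"

text \<open>Insert \<open>f = f(0) + primitive w\<close> and exchange the order of integration. The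
  function behind \<open>integral_above\<close> has derivative \<open>- \<psi>\<close>, the value
  \<open>primitive \<psi> L\<close> at 0 and the value 0 at \<open>L\<close>; hence no boundary term
  at \<open>L\<close> appears.\<close>

lemma H1_integration_by_parts:
  assumes "L > 0" and H1: "(f, w) \<in> H1 L" and \<psi>: "\<psi> \<in> L2 L"
  shows "inner w (integral_above L \<psi>) + pt_val L f 0 * primitive \<psi> L = inner f \<psi>"
proof -
  let ?p = "rep_l2 \<psi>"
  have i: "set_integrable lebesgue {0<..<L} (\<lambda>x. primitive w x * ?p x)"
    by (subst mult.commute) (rule set_integrable_mult_continuous[OF set_integrable_rep_l2 primitive_rep_continuous])
  have "inner f \<psi> = (LINT x:{0<..<L}|lebesgue. pt_val L f 0 * ?p x + primitive w x * ?p x)"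
    unfolding inner_l2_eq
  proof (subst set_lebesgue_integral_def, rule integral_cong_AE)
    show "(\<lambda>x. indicator {0<..<L} x *\<^sub>R (pt_val L f 0 * ?p x + primitive w x * ?p x)) \<in> borel_measurable lebesgue"
      using set_integral_add(1)[OF set_integrable_mult_right[OF set_integrable_rep_l2] i]
      by (simp add: set_integrable_def)
    have "AE x in lebesgue. x \<notin> {0<..<L} \<longrightarrow> ?p x = 0" using \<psi> by (simp add: L2_def)
    then show "AE x in lebesgue. rep_l2 f x * ?p x = indicator {0<..<L} x *\<^sub>R (pt_val L f 0 * ?p x + primitive w x * ?p x)"
      using H1_AE_eq[OF assms(1,2)] by eventually_elim (auto simp: algebra_simps split: split_indicator)
  qed measurable
  also have "\<dots> = pt_val L f 0 * primitive \<psi> L + (LINT x:{0<..<L}|lebesgue. primitive w x * ?p x)"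
    by (subst set_integral_add(2)[OF set_integrable_mult_right[OF set_integrable_rep_l2] i]) simp
  also have "(LINT x:{0<..<L}|lebesgue. primitive w x * ?p x)
      = (LINT y:{0<..<L}|lebesgue. rep_l2 w y * (LINT x:{y<..<L}|lebesgue. ?p x))"
    by (intro set_integral_Fubini_triangle set_integrable_rep_l2)
  also have "\<dots> = (LINT y:{0<..<L}|lebesgue. rep_l2 w y * (primitive \<psi> L - primitive \<psi> y))"
  proof (intro set_lebesgue_integral_cong allI impI)
    fix y assume "y \<in> {0<..<L}"
    then have "(LINT x:{y<..<L}|lebesgue. ?p x) = primitive \<psi> L - primitive \<psi> y"
      by (intro set_integral_split_Ioo[OF set_integrable_rep_l2[of L]]) auto
    then show "rep_l2 w y * (LINT x:{y<..<L}|lebesgue. ?p x) = rep_l2 w y * (primitive \<psi> L - primitive \<psi> y)" by simp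
  qed simp
  also have "\<dots> = inner w (integral_above L \<psi>)"
    unfolding integral_above_def
    by (subst inner_restrict) (auto intro!: continuous_intros primitive_rep_continuous)
  finally show ?thesis by simp
qed

subsection \<open>Integrated equations of weak solutions\<close>

text \<open>The equation is tested with a bounded functional \<open>l\<close>. On the domain of the
  operator the result is expressed by \<open>k\<close>, which may make sense for all states although
  \<open>A_op\<close> does not.\<close>

lemma strong_solution_has_integral:
  fixes l :: "state \<Rightarrow> real"
  assumes Y: "strong_solution L g F Y" and l: "bounded_linear l"
    and k: "\<And>Z. Z \<in> dom_A L g \<Longrightarrow> l (F_op F Z - A_op L Z) = k Z" and "t > 0"
  shows "((\<lambda>s. k (Y s)) has_integral (l (Y t) - l (Y 0))) {0..t}"
proof -
  let ?Y' = "\<lambda>s. F_op F (Y s) - A_op L (Y s)"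
  have "AE s in lebesgue. s \<ge> 0 \<longrightarrow> Y s \<in> dom_A L g \<and>
        (\<exists>X'. (Y has_vector_derivative X') (at s within {0..}) \<and> X' + A_op L (Y s) = F_op F (Y s))"
    using Y by (simp add: strong_solution_def)
  then obtain N where N: "N \<in> null_sets lebesgue"
    and ae: "{s \<in> space lebesgue. \<not> (s \<ge> 0 \<longrightarrow> Y s \<in> dom_A L g \<and>
        (\<exists>X'. (Y has_vector_derivative X') (at s within {0..}) \<and> X' + A_op L (Y s) = F_op F (Y s)))} \<subseteq> N"
    by (auto simp: eventually_ae_filter)
  have neg: "negligible N" using N by (simp add: negligible_iff_null_sets)
  have sol: "Y s \<in> dom_A L g \<and>
      (\<exists>X'. (Y has_vector_derivative X') (at s within {0..}) \<and> X' + A_op L (Y s) = F_op F (Y s))"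
    if "s \<in> {0..t} - N" for s
  proof -
    have "s \<ge> 0" "s \<notin> N" using that by auto
    then show ?thesis using ae unfolding space_completion space_lborel space_borel by blast
  qed
  have "(?Y' has_integral (Y t - Y 0)) {0..t}"
  proof (rule fundamental_theorem_of_calculus_abs_cont[OF _ _ neg])
    show "abs_cont_on 0 t Y" using Y \<open>t > 0\<close> by (simp add: strong_solution_def)
    fix s assume s: "s \<in> {0..t} - N"
    then obtain X' where X': "(Y has_vector_derivative X') (at s within {0..})" "X' + A_op L (Y s) = F_op F (Y s)"
      using sol by blast
    have "X' = ?Y' s" using X'(2) by (simp add: algebra_simps)
    then show "(Y has_vector_derivative ?Y' s) (at s within {0..t})"
      using X'(1) by (auto intro: has_vector_derivative_within_subset)
  qed (use \<open>t > 0\<close> in simp)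
  from has_integral_linear[OF this l]
  have "((l \<circ> ?Y') has_integral (l (Y t) - l (Y 0))) {0..t}"
    by (simp add: linear_diff[OF bounded_linear.linear[OF l]])
  \<comment> \<open>At the exceptional times \<open>Y s\<close> may lie outside the domain, but
    there the integrand can be changed freely.\<close>
  then show ?thesis
    by (rule has_integral_spike[OF neg, rotated]) (simp add: k[OF conjunct1[OF sol]])
qed

text \<open>The integrated identity contains only \<open>l\<close> and \<open>k\<close>, both
  continuous on the whole space, so it passes to uniform limits of strong solutions. The unbounded
  operator has disappeared into the choice of \<open>l\<close>.\<close>

lemma weak_solution_has_integral:
  fixes l :: "state \<Rightarrow> real"
  assumes X: "weak_solution L g F X" and l: "bounded_linear l" and lip: "C-lipschitz_on UNIV k"
    and k: "\<And>Z. Z \<in> dom_A L g \<Longrightarrow> l (F_op F Z - A_op L Z) = k Z" and "t > 0"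
  shows "((\<lambda>s. k (X s)) has_integral (l (X t) - l (X 0))) {0..t}"
proof -
  obtain Y where Y: "\<And>n::nat. strong_solution L g F (Y n)" and "\<forall>T>0. uniform_limit {0..T} Y X sequentially"
    using X by (auto simp: weak_solution_def)
  then have unif: "uniform_limit {0..t} Y X sequentially" using \<open>t > 0\<close> by blast
  have kc: "uniformly_continuous_on UNIV k" using lip by (rule lipschitz_on_uniformly_continuous)
  have "uniform_limit {0..t} (\<lambda>n s. k (Y n s)) (\<lambda>s. k (X s)) sequentially"
  proof (rule uniform_limitI)
    fix e :: real assume "e > 0"
    then obtain d where d: "d > 0" "\<And>x y. dist x y < d \<Longrightarrow> dist (k x) (k y) < e"
      using kc unfolding uniformly_continuous_on_def by (metis UNIV_I dist_commute)
    show "\<forall>\<^sub>F n in sequentially. \<forall>s\<in>{0..t}. dist (k (Y n s)) (k (X s)) < e"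
      using uniform_limitD[OF unif d(1)] by eventually_elim (use d(2) in blast)
  qed
  note k_unif = this
  have k_cont: "continuous_on {0..t} (\<lambda>s. k (Y n s))" for n
  proof (rule continuous_on_compose2[OF lipschitz_on_continuous_on[OF lip]])
    show "continuous_on {0..t} (Y n)"
      using Y[of n] \<open>t > 0\<close> by (intro abs_cont_on_imp_continuous_on) (simp add: strong_solution_def)
  qed simp
  obtain I J where I: "\<forall>n. ((\<lambda>s. k (Y n s)) has_integral I n) {0..t}"
    and J: "((\<lambda>s. k (X s)) has_integral J) {0..t}" and IJ: "I \<longlonglongrightarrow> J"
    by (rule uniform_limit_integral[OF k_unif k_cont]) (simp, rule that, auto)
  have I_eq: "I n = l (Y n t) - l (Y n 0)" for n
    using has_integral_unique[OF I[rule_format] strong_solution_has_integral[OF Y l k \<open>t > 0\<close>]] .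
  have "I \<longlonglongrightarrow> l (X t) - l (X 0)"
    unfolding I_eq[abs_def] using \<open>t > 0\<close> by (intro tendsto_diff bounded_linear.tendsto[OF l] tendsto_uniform_limitI[OF unif]) auto
  with IJ have "J = l (X t) - l (X 0)" by (rule LIMSEQ_unique)
  then show ?thesis using J by simp
qed

lemma norm_fst_le_norm: "norm (fst z) \<le> norm z"
  by (metis norm_fst_le prod.collapse)

lemma norm_snd_le_norm: "norm (snd z) \<le> norm z"
  by (metis norm_snd_le prod.collapse)

lemma dom_A_cases:
  assumes "L > 0" "Z \<in> dom_A L g"
  obtains u ux a v \<theta> where "Z = (((u, ux), a), (v, \<theta>))" "(ux, dx L ux) \<in> H1 L"
  using assms unfolding dom_A_def W_space_def by (auto simp: dx_eq)

lemma weak_solution_trace_has_integral: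
  assumes "L > 0" "weak_solution L g F X" "t > 0"
  shows "((\<lambda>s. snd (snd (X s))) has_integral (snd (fst (X t)) - snd (fst (X 0)))) {0..t}"
proof (rule weak_solution_has_integral[OF assms(2) _ _ _ assms(3), where C=1])
  show "1-lipschitz_on UNIV (\<lambda>Z::state. snd (snd Z))"
    by (rule lipschitz_onI) (auto intro: order_trans[OF dist_snd_le dist_snd_le])
  show "snd (fst (F_op F Z - A_op L Z)) = snd (snd Z)" if "Z \<in> dom_A L g" for Z
    by (rule dom_A_cases[OF assms(1) that]) simp
qed (intro bounded_linear_intros)

lemma weak_solution_displacement_has_integral:
  assumes "L > 0" "weak_solution L g F X" "t > 0"
  shows "((\<lambda>s. inner (fst (snd (X s))) w)
    has_integral (inner (fst (fst (fst (X t)))) w - inner (fst (fst (fst (X 0)))) w)) {0..t}"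
proof (rule weak_solution_has_integral[OF assms(2) _ _ _ assms(3), where C="norm w"])
  show "(norm w)-lipschitz_on UNIV (\<lambda>Z::state. inner (fst (snd Z)) w)"
  proof (rule lipschitz_onI)
    fix Z Z' :: state
    have "\<bar>inner (fst (snd Z)) w - inner (fst (snd Z')) w\<bar> \<le> norm (fst (snd (Z - Z'))) * norm w"
      by (simp add: inner_diff_left[symmetric] Cauchy_Schwarz_ineq2)
    also have "\<dots> \<le> norm (Z - Z') * norm w"
      by (rule mult_right_mono[OF order_trans[OF norm_fst_le_norm norm_snd_le_norm]]) simp
    finally show "dist (inner (fst (snd Z)) w) (inner (fst (snd Z')) w) \<le> norm w * dist Z Z'"
      by (simp add: dist_norm mult.commute)
  qed simp
  show "inner (fst (fst (fst (F_op F Z - A_op L Z)))) w = inner (fst (snd Z)) w" if "Z \<in> dom_A L g" for Z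
    by (rule dom_A_cases[OF assms(1) that]) simp
qed (intro bounded_linear_intros)

text \<open>The functional \<open>m\<close> pairs \<open>(v, \<theta>)\<close> with the test
  function \<open>integral_above L \<psi>\<close> and its value at 0. Integration by parts then
  turns the terms with the second derivative and with the slope at 0 into
  \<open>inner ux \<psi>\<close>, which is bounded on states; the feedback at \<open>L\<close> is
  invisible.\<close>

lemma weak_solution_momentum_has_integral:
  assumes "L > 0" "weak_solution L g F X" "t > 0" "\<psi> \<in> L2 L" and F: "C-lipschitz_on UNIV F"
  defines "m \<equiv> \<lambda>Z::state. inner (fst (snd Z)) (integral_above L \<psi>) + snd (snd Z) * primitive \<psi> L"
  shows "((\<lambda>s. inner (snd (fst (fst (X s)))) \<psi> + F (snd (snd (X s))) * primitive \<psi> L)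
    has_integral (m (X t) - m (X 0))) {0..t}"
proof (rule weak_solution_has_integral[OF assms(2) _ _ _ assms(3), where C="norm \<psi> + C * \<bar>primitive \<psi> L\<bar>"])
  have "C \<ge> 0" using F by (rule lipschitz_on_nonneg)
  then show "(norm \<psi> + C * \<bar>primitive \<psi> L\<bar>)-lipschitz_on UNIV
      (\<lambda>Z::state. inner (snd (fst (fst Z))) \<psi> + F (snd (snd Z)) * primitive \<psi> L)"
  proof (intro lipschitz_onI)
    fix Z Z' :: state
    let ?d = "dist Z Z'"
    have 0: "norm (snd (fst (fst (Z - Z')))) \<le> ?d"
      unfolding dist_norm by (rule order_trans[OF norm_snd_le_norm order_trans[OF norm_fst_le_norm norm_fst_le_norm]])
    have "\<bar>inner (snd (fst (fst Z))) \<psi> - inner (snd (fst (fst Z'))) \<psi>\<bar> \<le> norm (snd (fst (fst (Z - Z')))) * norm \<psi>"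
      by (simp add: inner_diff_left[symmetric] Cauchy_Schwarz_ineq2)
    also have "\<dots> \<le> ?d * norm \<psi>"
      using 0 by (rule mult_right_mono) simp
    finally have 1: "\<bar>inner (snd (fst (fst Z))) \<psi> - inner (snd (fst (fst Z'))) \<psi>\<bar> \<le> ?d * norm \<psi>" .
    have "\<bar>F (snd (snd Z)) - F (snd (snd Z'))\<bar> \<le> C * dist (snd (snd Z)) (snd (snd Z'))"
      using lipschitz_onD[OF F] by (simp add: dist_real_def)
    also have "\<dots> \<le> C * ?d"
      using \<open>C \<ge> 0\<close> by (intro mult_left_mono order_trans[OF dist_snd_le dist_snd_le])
    finally have "\<bar>F (snd (snd Z)) - F (snd (snd Z'))\<bar> * \<bar>primitive \<psi> L\<bar> \<le> C * ?d * \<bar>primitive \<psi> L\<bar>"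
      by (rule mult_right_mono) simp
    then have 2: "\<bar>(F (snd (snd Z)) - F (snd (snd Z'))) * primitive \<psi> L\<bar> \<le> C * ?d * \<bar>primitive \<psi> L\<bar>"
      by (simp only: abs_mult)
    show "dist (inner (snd (fst (fst Z))) \<psi> + F (snd (snd Z)) * primitive \<psi> L)
        (inner (snd (fst (fst Z'))) \<psi> + F (snd (snd Z')) * primitive \<psi> L)
        \<le> (norm \<psi> + C * \<bar>primitive \<psi> L\<bar>) * ?d"
      using 1 2 abs_triangle_ineq[of "inner (snd (fst (fst Z))) \<psi> - inner (snd (fst (fst Z'))) \<psi>"
          "(F (snd (snd Z)) - F (snd (snd Z'))) * primitive \<psi> L"]
      by (simp add: dist_real_def algebra_simps)
  qed simp
  show "m (F_op F Z - A_op L Z) = inner (snd (fst (fst Z))) \<psi> + F (snd (snd Z)) * primitive \<psi> L"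
    if Z: "Z \<in> dom_A L g" for Z
  proof -
    obtain u ux a v \<theta> where "Z = (((u, ux), a), (v, \<theta>))" "(ux, dx L ux) \<in> H1 L"
      using assms(1) Z by (rule dom_A_cases)
    then show ?thesis
      using H1_integration_by_parts[OF \<open>L > 0\<close> _ \<open>\<psi> \<in> L2 L\<close>, of ux "dx L ux"]
      by (simp add: m_def algebra_simps)
  qed
  show "bounded_linear m" unfolding m_def by (intro bounded_linear_intros)
qed

subsection \<open>Equilibria and their stability\<close>

lemma stationary_imp_energy_eq_0:
  assumes "L > 0" and X: "stationary_solution L g F X" and F: "C-lipschitz_on UNIV F" "F 0 = 0"
  shows "energy X = 0"
proof -
  obtain u ux a v \<theta> where X_eq: "X = (((u, ux), a), (v, \<theta>))" by (metis prod.collapse)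
  have w: "weak_solution L g F (\<lambda>_. X)" and ux: "ux \<in> L2 L"
    using X by (auto simp: X_eq stationary_solution_def state_space_def V_space_def H1_def)
  \<comment> \<open>Along a constant trajectory every integrated equation has zero increment, so its
    constant integrand must vanish.\<close>
  have const: "c = 0" if "((\<lambda>_. c) has_integral 0) {0..1::real}" for c :: real
    using has_integral_unique[OF that has_integral_const_real[of c 0 1]] by simp
  have "\<theta> = 0"
    using weak_solution_trace_has_integral[OF \<open>L > 0\<close> w, of 1] by (intro const) (simp add: X_eq)
  moreover have "inner v v = 0"
    using weak_solution_displacement_has_integral[OF \<open>L > 0\<close> w, of 1 v] by (intro const) (simp add: X_eq)
  \<comment> \<open>The choice \<open>\<psi> = ux\<close>; the term with \<open>F\<close> drops out
    below because \<open>\<theta> = 0\<close> and \<open>F 0 = 0\<close>.\<close>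
  moreover have "inner ux ux + F \<theta> * primitive ux L = 0"
    using weak_solution_momentum_has_integral[OF \<open>L > 0\<close> w _ ux F(1), of 1] by (intro const) (simp add: X_eq)
  ultimately show ?thesis using F(2) by (simp add: X_eq norm_Pair)
qed

text \<open>Zero energy forces \<open>ux\<close>, \<open>v\<close> and \<open>\<theta>\<close> to
  vanish. The boundary condition at \<open>L\<close> then reduces to \<open>g 0 = 0\<close>, and
  both operators vanish at the state, so the constant trajectory is already a strong solution and
  approximates itself.\<close>

lemma zero_energy_imp_stationary:
  assumes "L > 0" "g 0 = 0" "F 0 = 0" and X: "X \<in> zero_energy L"
  shows "stationary_solution L g F X"
proof -
  obtain u ux a v \<theta> where X_eq: "X = (((u, ux), a), (v, \<theta>))" by (metis prod.collapse)
  have "(norm ux)\<^sup>2 + (norm (v, \<theta>))\<^sup>2 = 0" using X by (simp add: X_eq zero_energy_def)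
  then have X0: "ux = 0" "v = 0" "\<theta> = 0"
    by (simp_all add: add_nonneg_eq_0_iff zero_prod_def[symmetric] prod_eq_iff)
  have H0: "(0, 0) \<in> H1 L" and pt0: "pt_val L 0 0 = 0" "pt_val L 0 L = 0"
    using const_H1(1)[OF \<open>L > 0\<close>, where c = 0] const_H1(2)[OF \<open>L > 0\<close>, where c = 0] \<open>L > 0\<close>
    by (simp_all add: zero_prod_def)
  have dx0: "dx L 0 = 0" using \<open>L > 0\<close> H0 by (rule dx_eq)
  have st: "X \<in> state_space L" using X by (simp add: zero_energy_def)
  then have dom: "X \<in> dom_A L g"
    using H0 pt0 dx0 X0 \<open>g 0 = 0\<close> by (auto simp: X_eq dom_A_def W_space_def state_space_def V_space_def)
  have "0 + A_op L X = F_op F X"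
    using dx0 pt0 X0 \<open>F 0 = 0\<close> by (simp add: X_eq zero_prod_def)
  then have "((\<lambda>_. X) has_vector_derivative 0) (at t within {0..}) \<and> 0 + A_op L X = F_op F X" for t
    using has_vector_derivative_const by blast
  then have "AE t in lebesgue. t \<ge> 0 \<longrightarrow> X \<in> dom_A L g \<and>
      (\<exists>X'. ((\<lambda>_. X) has_vector_derivative X') (at t within {0..}) \<and> X' + A_op L X = F_op F X)"
    using dom by blast
  then have "strong_solution L g F (\<lambda>_. X)"
    using st dom unfolding strong_solution_def abs_cont_on_def by simp
  then show ?thesis
    using st unfolding stationary_solution_def weak_solution_def
    by (auto intro!: exI[of _ "\<lambda>_ _. X"] uniform_limit_const)
qed

section \<open>The line of equilibria and its distance to a state\<close>

definition equilibrium :: "real \<Rightarrow> real \<Rightarrow> state" where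
  "equilibrium L c = (((c *\<^sub>R unit_fun L, 0), c), (0, 0))"

lemma energy_nonneg: "energy X \<ge> 0"
  by (cases X rule: energy.cases) simp

lemma equilibrium_in_zero_energy: "L > 0 \<Longrightarrow> equilibrium L c \<in> zero_energy L"
  using const_H1(1)[of L c] const_H1(2)[of L 0 c] const_H1(1)[of L 0]
  by (auto simp: equilibrium_def zero_energy_def state_space_def V_space_def H_space_def norm_Pair H1_def)

text \<open>The equilibrium has the same trace as \<open>X\<close>, so that coordinate of the
  difference is zero. The displacement is controlled by the Poincare inequality, and the remaining
  coordinates make up twice the energy.\<close>

lemma norm_diff_equilibrium:
  assumes "L > 0" and X: "X \<in> state_space L"
  shows "(norm (X - equilibrium L (snd (fst X))))\<^sup>2 \<le> 2 * (1 + L\<^sup>2) * energy X"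
proof -
  obtain u ux a v \<theta> where X_eq: "X = (((u, ux), a), (v, \<theta>))" by (metis prod.collapse)
  have "(u, ux) \<in> H1 L" "a = pt_val L u 0"
    using X by (auto simp: X_eq state_space_def V_space_def)
  then have "(norm (u - a *\<^sub>R unit_fun L))\<^sup>2 \<le> (L * norm ux)\<^sup>2"
    using H1_Poincare[OF \<open>L > 0\<close>] by (intro power_mono) auto
  moreover have "(norm (X - equilibrium L (snd (fst X))))\<^sup>2
      = (norm (u - a *\<^sub>R unit_fun L))\<^sup>2 + (norm ux)\<^sup>2 + ((norm v)\<^sup>2 + \<theta>\<^sup>2)"
    using norm_state_square[of "u - a *\<^sub>R unit_fun L" ux 0 v \<theta>] by (simp add: X_eq equilibrium_def)
  moreover have "2 * (1 + L\<^sup>2) * energy X = (1 + L\<^sup>2) * (norm ux)\<^sup>2 + ((norm v)\<^sup>2 + \<theta>\<^sup>2) + L\<^sup>2 * ((norm v)\<^sup>2 + \<theta>\<^sup>2)"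
    by (simp add: X_eq norm_Pair algebra_simps)
  moreover have "L\<^sup>2 * ((norm v)\<^sup>2 + \<theta>\<^sup>2) \<ge> 0" by simp
  ultimately show ?thesis unfolding power_mult_distrib distrib_right by linarith
qed

lemma zero_energy_eq_range:
  assumes "L > 0"
  shows "zero_energy L = range (equilibrium L)"
proof -
  have "X = equilibrium L (snd (fst X))" if "X \<in> zero_energy L" for X
    using norm_diff_equilibrium[OF assms, of X] that by (simp add: zero_energy_def)
  then show ?thesis using equilibrium_in_zero_energy[OF assms] by blast
qed

text \<open>Under the root, \<open>L\<close> is the squared norm of the constant function 1 and the
  summand 1 comes from the trace coordinate.\<close>

lemma norm_equilibrium_diff:
  assumes "L > 0"
  shows "norm (equilibrium L c - equilibrium L d) = sqrt (L + 1) * \<bar>c - d\<bar>"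
proof -
  have eq: "equilibrium L c - equilibrium L d = ((((c - d) *\<^sub>R unit_fun L, 0), c - d), (0, 0))"
    by (simp add: equilibrium_def scaleR_diff_left zero_prod_def)
  have "(norm (equilibrium L c - equilibrium L d))\<^sup>2 = (sqrt (L + 1) * \<bar>c - d\<bar>)\<^sup>2"
    unfolding eq norm_state_square using assms
    by (simp add: norm_unit_fun power_mult_distrib distrib_right)
  then show ?thesis using assms by (simp add: power2_eq_iff_nonneg)
qed

text \<open>The energy does not see constant displacements. Closeness to any equilibrium therefore
  makes the initial energy small, which is what Lyapunov stability starts from.\<close>

lemma energy_le_norm_diff_equilibrium: "energy X \<le> (norm (X - equilibrium L c))\<^sup>2"
proof (cases X rule: energy.cases)
  case (1 u ux a v \<theta>)
  then show ?thesis
    using norm_state_square[of "u - c *\<^sub>R unit_fun L" ux "a - c" v \<theta>]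
      zero_le_power2[of "norm (u - c *\<^sub>R unit_fun L)"] zero_le_power2[of "a - c"]
      zero_le_power2[of "norm ux"] zero_le_power2[of "norm v"] zero_le_power2[of \<theta>]
    by (simp add: equilibrium_def norm_Pair)
qed

lemma velocity_le_energy: "\<bar>snd (snd X)\<bar> \<le> sqrt (2 * energy X)"
  by (cases X rule: energy.cases) (auto intro!: real_le_rsqrt simp: norm_Pair)

section \<open>Convergence and stability from exponential decay of the energy\<close>

text \<open>The values at the integers form a Cauchy sequence. Letting the later time run to
  infinity through the integers bounds the distance to the limit at every real time \<open>s\<close>
  by \<open>b s\<close>.\<close>

lemma has_limit_at_top_if_dominated_increments:
  fixes f b :: "real \<Rightarrow> real"
  assumes inc: "\<And>s t. 0 \<le> s \<Longrightarrow> s \<le> t \<Longrightarrow> \<bar>f t - f s\<bar> \<le> b s" and b: "(b \<longlongrightarrow> 0) at_top"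
  shows "\<exists>l. (f \<longlongrightarrow> l) at_top"
proof -
  have "Cauchy (\<lambda>n::nat. f (real n))"
  proof (rule CauchyI')
    fix e :: real assume "e > 0"
    have "(\<lambda>n::nat. b (real n)) \<longlonglongrightarrow> 0" using filterlim_compose[OF b filterlim_real_sequentially] .
    then have "\<forall>\<^sub>F n::nat in sequentially. b (real n) < e" using \<open>e > 0\<close> by (rule order_tendstoD)
    then obtain M where M: "\<And>n. n \<ge> M \<Longrightarrow> b (real n) < e" by (auto simp: eventually_sequentially)
    show "\<exists>M::nat. \<forall>m\<ge>M. \<forall>n>m. dist (f (real m)) (f (real n)) < e"
    proof (intro exI allI impI)
      fix m n :: nat assume "m \<ge> M" "n > m"
      then show "dist (f (real m)) (f (real n)) < e"
        using inc[of "real m" "real n"] M[of m] by (simp add: dist_real_def abs_minus_commute)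
    qed
  qed
  then obtain l where l: "(\<lambda>n::nat. f (real n)) \<longlonglongrightarrow> l"
    by (metis Cauchy_convergent_iff convergent_def)
  have "\<bar>f s - l\<bar> \<le> b s" if "s \<ge> 0" for s
  proof (rule tendsto_upperbound)
    show "(\<lambda>n::nat. \<bar>f s - f (real n)\<bar>) \<longlonglongrightarrow> \<bar>f s - l\<bar>" by (intro tendsto_intros l)
    have "\<forall>\<^sub>F n::nat in sequentially. s \<le> real n"
      using filterlim_real_sequentially by (simp add: filterlim_at_top)
    then show "\<forall>\<^sub>F n::nat in sequentially. \<bar>f s - f (real n)\<bar> \<le> b s"
      by eventually_elim (use inc that in \<open>simp add: abs_minus_commute\<close>)
  qed simp
  then have "\<forall>\<^sub>F s in at_top. norm (f s - l) \<le> b s"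
    by (intro eventually_mono[OF eventually_ge_at_top[of 0]]) simp
  then have "((\<lambda>s. f s - l) \<longlongrightarrow> 0) at_top" using b by (rule Lim_null_comparison)
  then show ?thesis using LIM_zero_iff by blast
qed

text \<open>The trace is the time integral of the velocity, which is at most the square root of
  twice the energy. The root halves the decay rate, and integrating the exponential yields the
  factor \<open>2 / \<mu>\<close>.\<close>

lemma trace_increment_bound:
  assumes "L > 0" and X: "weak_solution L g F X" and "\<mu> > 0" "M > 0"
    and decay: "\<And>t. t \<ge> 0 \<Longrightarrow> energy (X t) \<le> M * exp (- \<mu> * t) * energy (X 0)"
    and st: "0 \<le> s" "s \<le> t"
  shows "\<bar>snd (fst (X t)) - snd (fst (X s))\<bar> \<le> 2 / \<mu> * sqrt (2 * M * energy (X 0)) * exp (- \<mu> * s / 2)"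
proof -
  let ?\<theta> = "\<lambda>r. snd (snd (X r))" and ?B = "sqrt (2 * M * energy (X 0))"
  have a: "(?\<theta> has_integral (snd (fst (X r)) - snd (fst (X 0)))) {0..r}" if "r \<ge> 0" for r
  proof (cases "r = 0")
    case False
    then show ?thesis using weak_solution_trace_has_integral[OF \<open>L > 0\<close> X, of r] that by simp
  qed (simp add: has_integral_refl)
  have int: "?\<theta> integrable_on {0..t}" using a[of t] st by (auto simp: integrable_on_def)
  have "integral {0..s} ?\<theta> + integral {s..t} ?\<theta> = integral {0..t} ?\<theta>"
    using st int by (rule Henstock_Kurzweil_Integration.integral_combine)
  then have diff: "snd (fst (X t)) - snd (fst (X s)) = integral {s..t} ?\<theta>"
    using a[of s] a[of t] st by (simp add: integral_unique)
  let ?G = "\<lambda>r. - (2 / \<mu>) * ?B * exp (- \<mu> * r / 2)"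
  have G: "((\<lambda>r. ?B * exp (- \<mu> * r / 2)) has_integral (?G t - ?G s)) {s..t}"
  proof (rule fundamental_theorem_of_calculus[OF st(2)])
    fix r
    have "(?G has_real_derivative ?B * exp (- \<mu> * r / 2)) (at r within {s..t})"
      using \<open>\<mu> > 0\<close> by (auto intro!: derivative_eq_intros simp: field_simps)
    then show "(?G has_vector_derivative ?B * exp (- \<mu> * r / 2)) (at r within {s..t})"
      by (simp add: has_real_derivative_iff_has_vector_derivative)
  qed
  have "norm (integral {s..t} ?\<theta>) \<le> integral {s..t} (\<lambda>r. ?B * exp (- \<mu> * r / 2))"
  proof (rule integral_norm_bound_integral)
    show "?\<theta> integrable_on {s..t}" using int st by (auto intro: integrable_on_subinterval)
    show "(\<lambda>r. ?B * exp (- \<mu> * r / 2)) integrable_on {s..t}" using G by (auto simp: integrable_on_def)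
    fix r assume r: "r \<in> {s..t}"
    have "\<bar>?\<theta> r\<bar> \<le> sqrt (2 * energy (X r))" by (rule velocity_le_energy)
    also have "\<dots> \<le> sqrt (2 * M * energy (X 0) * exp (- \<mu> * r))"
      using decay[of r] r st by (intro real_sqrt_le_mono) (simp add: algebra_simps)
    also have "\<dots> = ?B * exp (- \<mu> * r / 2)"
    proof -
      have "exp (- \<mu> * r) = (exp (- \<mu> * r / 2))\<^sup>2" by (simp add: power2_eq_square exp_add[symmetric])
      then show ?thesis by (simp add: real_sqrt_mult)
    qed
    finally show "norm (?\<theta> r) \<le> ?B * exp (- \<mu> * r / 2)" by simp
  qed
  also have "\<dots> = ?G t - ?G s" using G by (rule integral_unique)
  \<comment> \<open>The contribution of the upper end \<open>t\<close> is nonpositive and is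
    dropped.\<close>
  also have "\<dots> \<le> 2 / \<mu> * ?B * exp (- \<mu> * s / 2)"
    using \<open>\<mu> > 0\<close> \<open>M > 0\<close> energy_nonneg[of "X 0"] by simp
  finally show ?thesis by (simp add: diff)
qed

text \<open>Stated for an arbitrary family \<open>S\<close> of weak solutions with a common decay
  bound, so that it serves both for all solutions and for those of bounded initial energy. Each
  state is compared with the moving equilibrium of the same trace.\<close>

lemma pointwise_asymptotic_stability:
  assumes "L > 0" "M > 0" "\<mu> > 0" and S: "\<And>X. X \<in> S \<Longrightarrow> weak_solution L g F X"
    and decay: "\<And>X t. X \<in> S \<Longrightarrow> t \<ge> 0 \<Longrightarrow> energy (X t) \<le> M * exp (- \<mu> * t) * energy (X 0)"
  shows "pointwise_asymptotically_stable S (zero_energy L)"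
    and "\<exists>M'>0. \<forall>X\<in>S. \<forall>t\<ge>0. (infdist (X t) (zero_energy L))\<^sup>2 \<le> M' * exp (- \<mu> * t) * energy (X 0)"
proof -
  let ?a = "\<lambda>Z::state. snd (fst Z)" and ?M = "2 * (1 + L\<^sup>2) * M" and ?K = "2 / \<mu> * sqrt (2 * M)"
  have "?M > 0" using \<open>M > 0\<close> by (simp add: add_pos_nonneg)
  have trace: "\<bar>?a (X t) - ?a (X s)\<bar> \<le> ?K * sqrt (energy (X 0)) * exp (- \<mu> * s / 2)"
    if "X \<in> S" "0 \<le> s" "s \<le> t" for X s t
    using trace_increment_bound[OF \<open>L > 0\<close> S[OF that(1)] \<open>\<mu> > 0\<close> \<open>M > 0\<close> decay[OF that(1)] that(2,3)]
    by (simp add: real_sqrt_mult mult.assoc)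
  have near: "(norm (X t - equilibrium L (?a (X t))))\<^sup>2 \<le> ?M * exp (- \<mu> * t) * energy (X 0)"
    if "X \<in> S" "t \<ge> 0" for X t
  proof -
    have "X t \<in> state_space L" using S[OF that(1)] that(2) by (simp add: weak_solution_def)
    then have "(norm (X t - equilibrium L (?a (X t))))\<^sup>2 \<le> 2 * (1 + L\<^sup>2) * energy (X t)"
      by (rule norm_diff_equilibrium[OF \<open>L > 0\<close>])
    also have "\<dots> \<le> 2 * (1 + L\<^sup>2) * (M * exp (- \<mu> * t) * energy (X 0))"
      using decay[OF that] by (intro mult_left_mono) auto
    finally show ?thesis by (simp add: mult.assoc)
  qed
  show "\<exists>M'>0. \<forall>X\<in>S. \<forall>t\<ge>0. (infdist (X t) (zero_energy L))\<^sup>2 \<le> M' * exp (- \<mu> * t) * energy (X 0)"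
  proof (intro exI[of _ ?M] conjI ballI allI impI)
    fix X and t :: real assume X: "X \<in> S" "t \<ge> 0"
    have "infdist (X t) (zero_energy L) \<le> dist (X t) (equilibrium L (?a (X t)))"
      by (rule infdist_le[OF equilibrium_in_zero_energy[OF \<open>L > 0\<close>]])
    then have "(infdist (X t) (zero_energy L))\<^sup>2 \<le> (norm (X t - equilibrium L (?a (X t))))\<^sup>2"
      unfolding dist_norm by (rule power_mono) (rule infdist_nonneg)
    then show "(infdist (X t) (zero_energy L))\<^sup>2 \<le> ?M * exp (- \<mu> * t) * energy (X 0)"
      using near[OF X] by linarith
  qed fact
  have stable: "lyapunov_stable S (equilibrium L c)" for c
    unfolding lyapunov_stable_def
  proof (intro allI impI)
    fix \<epsilon> :: real assume "\<epsilon> > 0"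
    \<comment> \<open>The first summand bounds the distance to the moving equilibrium. In the
      second, \<open>?K\<close> bounds the drift of the trace, 1 accounts for its initial deviation
      from \<open>c\<close>, and \<open>sqrt (L + 1)\<close> converts traces to equilibria. The
      final \<open>\<delta>\<close> is \<open>\<epsilon> / C\<close>.\<close>
    define C where "C = sqrt ?M + sqrt (L + 1) * (?K + 1)"
    have "?K > 0" using \<open>M > 0\<close> \<open>\<mu> > 0\<close> by simp
    then have "sqrt (L + 1) * (?K + 1) > 0" using \<open>L > 0\<close> by (intro mult_pos_pos) (simp, linarith)
    then have "C > 0" using real_sqrt_gt_zero[OF \<open>?M > 0\<close>] unfolding C_def by linarith
    have "norm (X t - equilibrium L c) \<le> C * norm (X 0 - equilibrium L c)" if "X \<in> S" "t \<ge> 0" for X t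
    proof -
      let ?d = "norm (X 0 - equilibrium L c)"
      have E: "energy (X 0) \<le> ?d\<^sup>2" by (rule energy_le_norm_diff_equilibrium)
      then have sE: "sqrt (energy (X 0)) \<le> ?d" by (intro real_le_lsqrt energy_nonneg) auto
      have "(norm (X t - equilibrium L (?a (X t))))\<^sup>2 \<le> ?M * 1 * ?d\<^sup>2"
        using that \<open>\<mu> > 0\<close> \<open>M > 0\<close> E energy_nonneg[of "X 0"]
        by (intro order_trans[OF near[OF that]] mult_mono) auto
      then have "norm (X t - equilibrium L (?a (X t))) \<le> sqrt (?M * ?d\<^sup>2)"
        by (intro real_le_rsqrt) simp
      then have 1: "norm (X t - equilibrium L (?a (X t))) \<le> sqrt ?M * ?d"
        unfolding real_sqrt_mult[of ?M] real_sqrt_abs abs_norm_cancel .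
      have "\<bar>?a (X t) - ?a (X 0)\<bar> \<le> ?K * ?d"
        using trace[OF that(1), of 0 t] that(2) mult_left_mono[OF sE, of ?K] \<open>?K > 0\<close> by simp
      moreover have "\<bar>?a (X 0) - c\<bar> \<le> ?d"
      proof -
        have "\<bar>?a (X 0) - c\<bar> = norm (snd (fst (X 0 - equilibrium L c)))" by (simp add: equilibrium_def)
        also have "\<dots> \<le> ?d" by (rule order_trans[OF norm_snd_le_norm norm_fst_le_norm])
        finally show ?thesis .
      qed
      ultimately have "\<bar>?a (X t) - c\<bar> \<le> (?K + 1) * ?d" by (simp add: algebra_simps)
      then have 2: "norm (equilibrium L (?a (X t)) - equilibrium L c) \<le> sqrt (L + 1) * ((?K + 1) * ?d)"
        unfolding norm_equilibrium_diff[OF \<open>L > 0\<close>] using \<open>L > 0\<close> by (intro mult_left_mono) auto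
      have "norm (X t - equilibrium L c)
          \<le> norm (X t - equilibrium L (?a (X t))) + norm (equilibrium L (?a (X t)) - equilibrium L c)"
        using norm_triangle_ineq[of "X t - equilibrium L (?a (X t))" "equilibrium L (?a (X t)) - equilibrium L c"]
        by simp
      also have "\<dots> \<le> C * ?d" using 1 2 by (simp add: C_def distrib_right mult.assoc)
      finally show ?thesis .
    qed
    then have "\<forall>X\<in>S. norm (X 0 - equilibrium L c) \<le> \<epsilon> / C \<longrightarrow> (\<forall>t\<ge>0. norm (X t - equilibrium L c) \<le> \<epsilon>)"
      using \<open>C > 0\<close> by (fastforce simp: pos_le_divide_eq mult.commute intro: order_trans)
    then show "\<exists>\<delta>>0. \<forall>X\<in>S. norm (X 0 - equilibrium L c) \<le> \<delta> \<longrightarrow> (\<forall>t\<ge>0. norm (X t - equilibrium L c) \<le> \<epsilon>)"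
      using \<open>\<epsilon> > 0\<close> \<open>C > 0\<close> by (intro exI[of _ "\<epsilon> / C"]) simp
  qed
  have exp0: "((\<lambda>t. c * exp (- r * t)) \<longlongrightarrow> 0) at_top" if "r > 0" for c r :: real
  proof -
    have "filterlim (\<lambda>t. - r * t) at_bot at_top"
      using that by (intro filterlim_tendsto_neg_mult_at_bot[OF tendsto_const _ filterlim_ident]) simp
    then have "((\<lambda>t. exp (- r * t)) \<longlongrightarrow> 0) at_top" by (rule filterlim_compose[OF exp_at_bot])
    then show ?thesis by (rule tendsto_mult_right_zero)
  qed
  have conv: "\<exists>Y\<in>zero_energy L. (X \<longlongrightarrow> Y) at_top" if X: "X \<in> S" for X
  proof -
    have b0: "((\<lambda>s. ?K * sqrt (energy (X 0)) * exp (- \<mu> * s / 2)) \<longlongrightarrow> 0) at_top"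
      using exp0[of "\<mu> / 2" "?K * sqrt (energy (X 0))"] \<open>\<mu> > 0\<close> by simp
    have "\<exists>l. ((\<lambda>t. ?a (X t)) \<longlongrightarrow> l) at_top"
      by (rule has_limit_at_top_if_dominated_increments[OF _ b0]) (rule trace[OF X])
    then obtain l where l: "((\<lambda>t. ?a (X t)) \<longlongrightarrow> l) at_top" ..
    have "((\<lambda>t. (norm (X t - equilibrium L (?a (X t))))\<^sup>2) \<longlongrightarrow> 0) at_top"
    proof (rule Lim_null_comparison)
      show "\<forall>\<^sub>F t in at_top. norm ((norm (X t - equilibrium L (?a (X t))))\<^sup>2) \<le> (?M * energy (X 0)) * exp (- \<mu> * t)"
        using eventually_ge_at_top[of 0] by eventually_elim (use near[OF X] in \<open>simp add: algebra_simps\<close>)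
    qed (rule exp0[OF \<open>\<mu> > 0\<close>])
    from tendsto_real_sqrt[OF this]
    have diff: "((\<lambda>t. X t - equilibrium L (?a (X t))) \<longlongrightarrow> 0) at_top" by (simp add: tendsto_norm_zero_iff)
    have "((\<lambda>t. equilibrium L (?a (X t))) \<longlongrightarrow> equilibrium L l) at_top"
      unfolding equilibrium_def by (intro tendsto_intros l)
    \<comment> \<open>The state is the vanishing difference plus the moving equilibrium, and the
      latter converges because its trace does.\<close>
    from tendsto_add[OF diff this] have "(X \<longlongrightarrow> equilibrium L l) at_top" by simp
    then show ?thesis using equilibrium_in_zero_energy[OF \<open>L > 0\<close>] by blast
  qed
  show "pointwise_asymptotically_stable S (zero_energy L)"
    unfolding pointwise_asymptotically_stable_def using stable conv
    by (auto simp: zero_energy_eq_range[OF \<open>L > 0\<close>])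
qed

theorem corollary2:
  fixes L q \<alpha>\<^sub>1 \<alpha>\<^sub>2 :: real and g F :: "real \<Rightarrow> real"
  assumes "L > 0"
    and "continuous_on UNIV g" and "mono g" and "g 0 = 0"
    and "\<exists>C. C-lipschitz_on UNIV F" and "F 0 = 0"
    and "0 < q" and "q < 1/2"
    and "0 < \<alpha>\<^sub>1" and "\<alpha>\<^sub>1 \<le> \<alpha>\<^sub>2"
    and "\<And>s. \<alpha>\<^sub>1 * \<bar>s\<bar> \<le> \<bar>g s\<bar>" and "\<And>s. \<bar>g s\<bar> \<le> \<alpha>\<^sub>2 * \<bar>s\<bar>"
    and "\<alpha>\<^sub>1 / (1 + \<alpha>\<^sub>2\<^sup>2) > q"
  shows
    "zero_energy L = {X. stationary_solution L g F X}
     \<and> (\<forall>M \<mu>. q-lipschitz_on UNIV F \<longrightarrow> M > 0 \<longrightarrow> \<mu> > 0 \<longrightarrow>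
          (\<forall>X t. weak_solution L g F X \<longrightarrow> t \<ge> 0 \<longrightarrow>
             energy (X t) \<le> M * exp (- \<mu> * t) * energy (X 0)) \<longrightarrow>
          pointwise_asymptotically_stable {X. weak_solution L g F X} (zero_energy L)
          \<and> (\<exists>M'>0. \<forall>X t. weak_solution L g F X \<longrightarrow> t \<ge> 0 \<longrightarrow>
               (infdist (X t) (zero_energy L))\<^sup>2 \<le> M' * exp (- \<mu> * t) * energy (X 0)))
     \<and> (\<forall>R M \<mu>. (\<exists>U. open U \<and> 0 \<in> U \<and> q-lipschitz_on U F) \<longrightarrow> R > 0 \<longrightarrow> M > 0 \<longrightarrow> \<mu> > 0 \<longrightarrow>
          (\<forall>X t. weak_solution L g F X \<longrightarrow> energy (X 0) \<le> R \<longrightarrow> t \<ge> 0 \<longrightarrow>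
             energy (X t) \<le> M * exp (- \<mu> * t) * energy (X 0)) \<longrightarrow>
          pointwise_asymptotically_stable
            {X. weak_solution L g F X \<and> energy (X 0) \<le> R} (zero_energy L)
          \<and> (\<exists>M'>0. \<forall>X t. weak_solution L g F X \<longrightarrow> energy (X 0) \<le> R \<longrightarrow> t \<ge> 0 \<longrightarrow>
               (infdist (X t) (zero_energy L))\<^sup>2 \<le> M' * exp (- \<mu> * t) * energy (X 0)))"
proof (intro conjI allI impI, goal_cases)
  case 1
  obtain C where F: "C-lipschitz_on UNIV F" using assms(5) by blast
  have "X \<in> zero_energy L" if "stationary_solution L g F X" for X
    using that stationary_imp_energy_eq_0[OF \<open>L > 0\<close> that F \<open>F 0 = 0\<close>]
    by (simp add: zero_energy_def stationary_solution_def)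
  then show ?case
    using zero_energy_imp_stationary[OF \<open>L > 0\<close>, where g = g and F = F] \<open>g 0 = 0\<close> \<open>F 0 = 0\<close> by blast
next
  case (2 M \<mu>)
  then show ?case
    by (intro pointwise_asymptotic_stability(1)[OF \<open>L > 0\<close> \<open>M > 0\<close> \<open>\<mu> > 0\<close>]) auto
next
  case (3 M \<mu>)
  have "\<exists>M'>0. \<forall>X\<in>{X. weak_solution L g F X}. \<forall>t\<ge>0.
      (infdist (X t) (zero_energy L))\<^sup>2 \<le> M' * exp (- \<mu> * t) * energy (X 0)"
    by (rule pointwise_asymptotic_stability(2)[OF \<open>L > 0\<close> \<open>M > 0\<close> \<open>\<mu> > 0\<close>]) (use 3 in auto)
  then show ?case by auto
next
  case (4 R M \<mu>)
  then show ?case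
    by (intro pointwise_asymptotic_stability(1)[OF \<open>L > 0\<close> \<open>M > 0\<close> \<open>\<mu> > 0\<close>]) auto
next
  case (5 R M \<mu>)
  have "\<exists>M'>0. \<forall>X\<in>{X. weak_solution L g F X \<and> energy (X 0) \<le> R}. \<forall>t\<ge>0.
      (infdist (X t) (zero_energy L))\<^sup>2 \<le> M' * exp (- \<mu> * t) * energy (X 0)"
    by (rule pointwise_asymptotic_stability(2)[OF \<open>L > 0\<close> \<open>M > 0\<close> \<open>\<mu> > 0\<close>]) (use 5 in auto)
  then show ?case by auto
qed

end
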